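(* Let $K$ be a field, fix a monomial order $<$ on $K[x_1,\ldots,x_n]$, and let $I\subset K[x_1,\ldots,x_n]$ be a nonzero equigenerated graded ideal. Then $$\mu(I^2)\geq \ell(I')\,\mu(I)-\binom{\ell(I')}{2}.$$ In particular, if $I$ is a monomial ideal, then $\mu(I^2)\geq \ell(I)\,\mu(I)-\binom{\ell(I)}{2}$.
   Context: $S=K[x_1,\ldots,x_n]$ is the standard graded polynomial ring over a field $K$, with $\mathfrak{m}=(x_1,\ldots,x_n)$. For a graded ideal $L$, $\mu(L)$ is the minimal number of generators of $L$. A graded ideal is equigenerated if it is generated by homogeneous elements all of the same degree. The fiber ring of a graded ideal $L$ is the standard graded $K$-algebra $F(L)=\bigoplus_{k\geq 0}L^k/\mathfrak{m}L^k$, and the analytic spread $\ell(L)$ is the Krull dimension of $F(L)$. If $L$ is a graded ideal with $L_d\neq 0$ and $L_i=0$ for $i<d$, then $L'$ denotes the ideal generated by the monomials of degree $d$ in the initial ideal $\mathrm{in}_<(L)$. *)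

theory Defs
  imports
    "HOL-Library.Poly_Mapping"
    "HOL-Library.Extended_Nat"
    "HOL-Algebra.Ideal_Product"
    "HOL-Algebra.QuotRing"
    "HOL-Algebra.Algebraic_Closure_Type"
begin

section \<open>The polynomial ring\<close>

text \<open>
  A finite index type \<open>'x\<close> of cardinality \<open>n\<close> stands for \<open>{1, \<dots>, n}\<close>. A monomial is its exponent
  vector; the multiplication of \<^theory>\<open>HOL-Library.Poly_Mapping\<close> is convolution, which turns
  finitely supported functions on exponent vectors into \<open>K[x\<^sub>1, \<dots>, x\<^sub>n]\<close>.
\<close>

type_synonym 'x mon = "'x \<Rightarrow>\<^sub>0 nat"
type_synonym ('x, 'k) mpol = "'x mon \<Rightarrow>\<^sub>0 'k"

abbreviation polyring :: "('x::finite, 'k::field) mpol ring"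
  where "polyring \<equiv> ring_of_type_algebra"

definition mon_poly :: "'x mon \<Rightarrow> ('x::finite, 'k::field) mpol"
  where "mon_poly s = Poly_Mapping.single s 1"

definition mon_deg :: "('x::finite) mon \<Rightarrow> nat"
  where "mon_deg s = (\<Sum>x\<in>UNIV. Poly_Mapping.lookup s x)"

definition irrelevant_ideal :: "('x::finite, 'k::field) mpol set"
  where "irrelevant_ideal =
    Idl\<^bsub>polyring\<^esub> (range (\<lambda>x. mon_poly (Poly_Mapping.single x 1)))"

definition ideal_power :: "('x::finite, 'k::field) mpol set \<Rightarrow> nat \<Rightarrow> ('x, 'k) mpol set"
  where "ideal_power L k = L [^]\<^bsub>ideals_set polyring\<^esub> k"

section \<open>Graded ideals\<close>

definition homogeneous :: "nat \<Rightarrow> ('x::finite, 'k::field) mpol \<Rightarrow> bool"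
  where "homogeneous d f \<longleftrightarrow> (\<forall>s\<in>Poly_Mapping.keys f. mon_deg s = d)"

definition hom_component :: "nat \<Rightarrow> ('x::finite, 'k::field) mpol \<Rightarrow> ('x, 'k) mpol"
  where "hom_component d f =
    (\<Sum>s\<in>{s \<in> Poly_Mapping.keys f. mon_deg s = d}. Poly_Mapping.single s (Poly_Mapping.lookup f s))"

definition graded_ideal :: "('x::finite, 'k::field) mpol set \<Rightarrow> bool"
  where "graded_ideal L \<longleftrightarrow>
    ideal L polyring \<and> (\<forall>f\<in>L. \<forall>d. hom_component d f \<in> L)"

definition equigenerated :: "('x::finite, 'k::field) mpol set \<Rightarrow> bool"
  where "equigenerated L \<longleftrightarrow>
    (\<exists>d B. (\<forall>f\<in>B. homogeneous d f) \<and> L = Idl\<^bsub>polyring\<^esub> B)"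

definition monomial_ideal :: "('x::finite, 'k::field) mpol set \<Rightarrow> bool"
  where "monomial_ideal L \<longleftrightarrow> (\<exists>M. L = Idl\<^bsub>polyring\<^esub> (mon_poly ` M))"

definition num_gens :: "('x::finite, 'k::field) mpol set \<Rightarrow> nat"
  where "num_gens L = (LEAST c. \<exists>B. finite B \<and> card B = c \<and> L = Idl\<^bsub>polyring\<^esub> B)"

section \<open>Initial ideals\<close>

text \<open>The argument is the reflexive order relation.\<close>

definition monomial_order :: "(('x::finite) mon \<Rightarrow> 'x mon \<Rightarrow> bool) \<Rightarrow> bool"
  where "monomial_order mle \<longleftrightarrow>
    class.linorder mle (\<lambda>s t. mle s t \<and> s \<noteq> t) \<and>
    (\<forall>s. mle 0 s) \<and>
    (\<forall>s t u. mle s t \<longrightarrow> mle (s + u) (t + u))"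

text \<open>Only meaningful for \<open>f \<noteq> 0\<close>.\<close>

definition initial_mon ::
    "('x mon \<Rightarrow> 'x mon \<Rightarrow> bool) \<Rightarrow> ('x::finite, 'k::field) mpol \<Rightarrow> 'x mon"
  where "initial_mon mle f = (THE s. s \<in> Poly_Mapping.keys f \<and> (\<forall>t\<in>Poly_Mapping.keys f. mle t s))"

definition initial_ideal ::
    "('x mon \<Rightarrow> 'x mon \<Rightarrow> bool) \<Rightarrow> ('x::finite, 'k::field) mpol set \<Rightarrow> ('x, 'k) mpol set"
  where "initial_ideal mle L =
    Idl\<^bsub>polyring\<^esub> {mon_poly (initial_mon mle f) | f. f \<in> L \<and> f \<noteq> 0}"

text \<open>The \<open>d\<close> with \<open>L\<^sub>d \<noteq> 0\<close> and \<open>L\<^sub>i = 0\<close> for \<open>i < d\<close>, for a nonzero graded ideal \<open>L\<close>.\<close>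

definition initial_degree :: "('x::finite, 'k::field) mpol set \<Rightarrow> nat"
  where "initial_degree L = (LEAST d. \<exists>f\<in>L. f \<noteq> 0 \<and> homogeneous d f)"

text \<open>The ideal \<open>L'\<close>.\<close>

definition lowest_initial_ideal ::
    "('x mon \<Rightarrow> 'x mon \<Rightarrow> bool) \<Rightarrow> ('x::finite, 'k::field) mpol set \<Rightarrow> ('x, 'k) mpol set"
  where "lowest_initial_ideal mle L =
    Idl\<^bsub>polyring\<^esub> {mon_poly s | s. mon_deg s = initial_degree L \<and> mon_poly s \<in> initial_ideal mle L}"

section \<open>Fiber ring and analytic spread\<close>

text \<open>
  The direct sum of the \<open>L\<^sup>k / \<mm>L\<^sup>k\<close>: its elements are the families of cosets \<open>f k\<close>, almost all
  of them zero. The summand \<open>L\<^sup>k / \<mm>L\<^sup>k\<close> is viewed inside the quotient ring \<open>S / \<mm>L\<^sup>k\<close>, whose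
  addition is the one of the summand. The product of \<open>a + \<mm>L\<^sup>i\<close> and \<open>b + \<mm>L\<^sup>j\<close> is
  \<open>ab + \<mm>L\<^sup>i\<^sup>+\<^sup>j\<close>; this is \<^const>\<open>rcoset_mult\<close> with modulus \<open>\<mm>L\<^sup>i\<^sup>+\<^sup>j\<close>, although its two
  arguments are cosets of \<open>\<mm>L\<^sup>i\<close> and \<open>\<mm>L\<^sup>j\<close>.
\<close>

definition fiber_mod :: "('x::finite, 'k::field) mpol set \<Rightarrow> nat \<Rightarrow> ('x, 'k) mpol set"
  where "fiber_mod L k = irrelevant_ideal \<cdot>\<^bsub>polyring\<^esub> ideal_power L k"

definition fiber_ring :: "('x::finite, 'k::field) mpol set \<Rightarrow> (nat \<Rightarrow> ('x, 'k) mpol set) ring"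
  where "fiber_ring L =
    \<lparr>carrier = {f. (\<forall>k. f k \<in> (\<lambda>a. fiber_mod L k +>\<^bsub>polyring\<^esub> a) ` ideal_power L k) \<and>
                   finite {k. f k \<noteq> fiber_mod L k}},
     monoid.mult = (\<lambda>f g k. \<Oplus>\<^bsub>polyring Quot fiber_mod L k\<^esub>i\<in>{..k}.
                        rcoset_mult polyring (fiber_mod L k) (f i) (g (k - i))),
     one = (\<lambda>k. if k = 0 then fiber_mod L 0 +>\<^bsub>polyring\<^esub> \<one>\<^bsub>polyring\<^esub> else fiber_mod L k),
     ring.zero = fiber_mod L,
     add = (\<lambda>f g k. f k <+>\<^bsub>polyring\<^esub> g k)\<rparr>"

text \<open>The supremum of the lengths of chains of prime ideals (\<open>0\<close> for the zero ring).\<close>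

definition krull_dim :: "('a, 'b) ring_scheme \<Rightarrow> enat"
  where "krull_dim R =
    Sup {enat c | c. \<exists>P. (\<forall>i\<le>c. primeideal (P i) R) \<and> (\<forall>i<c. P i \<subset> P (Suc i))}"

text \<open>
  The fiber ring is a finitely generated algebra over a field, so its dimension is finite;
  \<^const>\<open>the_enat\<close> is unspecified at infinity.
\<close>

definition analytic_spread :: "('x::finite, 'k::field) mpol set \<Rightarrow> nat"
  where "analytic_spread L = the_enat (krull_dim (fiber_ring L))"

end

theory Submission
  imports
    Defs
    "HOL-Analysis.Cartesian_Euclidean_Space"
    "HOL-Library.Set_Algebras"
begin

text \<open>
  Let \<open>I\<close> be generated in degree \<open>d\<close>, and let \<open>A\<close> be the set of initial monomials of the nonzero forms of
  degree \<open>d\<close> in \<open>I\<close>. Three facts reduce the inequality to the combinatorics of \<open>A\<close>. The ideal \<open>I'\<close> is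
  generated by the monomials in \<open>A\<close>. Gaussian elimination shows that \<open>I\<close> is generated by one form for
  each element of \<open>A\<close>, so \<open>\<mu>(I) \<le> |A|\<close>. Since initial monomials are multiplicative, the component of \<open>I\<^sup>2\<close>
  in degree \<open>2d\<close> has dimension at least \<open>|A + A|\<close>, so \<open>\<mu>(I\<^sup>2) \<ge> |A + A|\<close>.

  Let \<open>r\<close> be the rank of the vectors \<open>(1, a)\<close> with \<open>a \<in> A\<close>. Freiman's inequality
  \<open>|A + A| \<ge> r |A| - (r choose 2)\<close> is proved by removing the smallest element of \<open>A\<close> in the monomial
  order (\<open>freiman_inequality\<close>). Since \<open>r \<le> |A|\<close> and \<open>l |A| - (l choose 2)\<close> increases with \<open>l\<close> as long as
  \<open>l \<le> |A|\<close>, it remains to see that \<open>\<ell>(I') \<le> r\<close>.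

  For this, the toric ring \<open>K[x\<^sup>a t | a \<in> A]\<close> maps onto the fiber ring of \<open>I'\<close>, and chains of primes pull
  back along this map. A chain of length \<open>c\<close> yields \<open>c\<close> elements whose monomials are linearly
  independent (\<open>prime_chain_independent_monomials\<close>). The number of monomials of degree at most \<open>n\<close> in
  the toric ring is bounded by a constant times \<open>n\<^sup>r\<close> for \<open>n \<ge> 1\<close> (\<open>card_graded_exponents_le\<close>), and
  comparing the growth of the two gives \<open>c \<le> r\<close> (\<open>analytic_spread_le_affine_rank\<close>).

  If \<open>I\<close> is itself a monomial ideal, then \<open>I' = I\<close>.
\<close>

section \<open>Freiman's inequality for monomials\<close>

text \<open>
  The additional coordinate makes affine relations among exponent vectors linear ones, so that the
  rank of \<open>(1, a)\<close> for \<open>a \<in> A\<close> is one more than the affine dimension of a nonempty set \<open>A\<close>. The same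
  vectors are the exponents of the generators of the toric ring, with \<open>k\<close> as the degree.
\<close>

definition graded_exponent :: "nat \<Rightarrow> ('x::finite) mon \<Rightarrow> real \<times> (real ^ 'x)"
  where "graded_exponent k s = (real k, \<chi> x. real (Poly_Mapping.lookup s x))"

definition affine_rank :: "('x::finite) mon set \<Rightarrow> nat"
  where "affine_rank A = dim (graded_exponent 1 ` A)"

lemma graded_exponent_add:
  "graded_exponent (k + l) (s + t) = graded_exponent k s + graded_exponent l t"
  by (simp add: graded_exponent_def lookup_add vec_eq_iff)

lemma graded_exponent_eq_iff [simp]:
  "graded_exponent k s = graded_exponent l t \<longleftrightarrow> k = l \<and> s = t"
  by (auto simp: graded_exponent_def vec_eq_iff intro: poly_mapping_eqI)

lemma monomial_order_add_strict:
  assumes "monomial_order mle" "mle s t" "s \<noteq> t"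
  shows "mle (s + u) (t + u) \<and> s + u \<noteq> t + u"
  using assms unfolding monomial_order_def by auto

lemma affine_rank_le_card:
  assumes "finite A"
  shows "affine_rank A \<le> card A"
  using assms unfolding affine_rank_def
  by (metis card_image_le dim_le_card dual_order.trans finite_imageI span_superset)

lemma monomial_order_antisym:
  "monomial_order mle \<Longrightarrow> mle s t \<Longrightarrow> mle t s \<Longrightarrow> s = t"
  unfolding monomial_order_def class.linorder_def class.order_def class.order_axioms_def by blast

lemma monomial_order_linorder:
  "monomial_order mle \<Longrightarrow> class.linorder mle (\<lambda>s t. mle s t \<and> s \<noteq> t)"
  unfolding monomial_order_def by blast

lemma monomial_order_finite_minimum:
  assumes "monomial_order mle" "finite A" "A \<noteq> {}"
  obtains v where "v \<in> A" "\<And>s. s \<in> A \<Longrightarrow> mle v s"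
proof -
  interpret linorder mle "\<lambda>s t. mle s t \<and> s \<noteq> t"
    using assms(1) by (rule monomial_order_linorder)
  show ?thesis using that[of "Min A"] assms(2,3) by simp
qed

lemma monomial_order_finite_induct:
  assumes order: "monomial_order mle" and fin: "finite A"
    and step: "\<And>s. s \<in> A \<Longrightarrow> (\<And>t. t \<in> A \<Longrightarrow> mle t s \<Longrightarrow> t \<noteq> s \<Longrightarrow> P t) \<Longrightarrow> P s"
    and "s \<in> A"
  shows "P s"
proof -
  interpret linorder mle "\<lambda>s t. mle s t \<and> s \<noteq> t"
    using order by (rule monomial_order_linorder)
  show ?thesis
    using \<open>s \<in> A\<close>
  proof (induction "card {t \<in> A. mle t s \<and> t \<noteq> s}" arbitrary: s rule: less_induct)
    case less
    show ?case
    proof (rule step[OF less.prems])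
      fix t assume t: "t \<in> A" "mle t s" "t \<noteq> s"
      have "{u \<in> A. mle u t \<and> u \<noteq> t} \<subset> {u \<in> A. mle u s \<and> u \<noteq> s}"
        using t by (auto intro: order.trans)
      then show "P t" using less.hyps[OF _ t(1)] fin by (simp add: psubset_card_mono)
    qed
  qed
qed

text \<open>
  This replaces the edges at a vertex of the convex hull in the usual proof of Freiman's inequality.
  Seen from the minimum \<open>v\<close>, an element \<open>s\<close> that is not irreducible satisfies
  \<open>s - v = (a - v) + (b - v)\<close> with \<open>a\<close> and \<open>b\<close> strictly below \<open>s\<close>, so induction along the order
  expresses every element by irreducible ones.
\<close>

lemma minimum_and_irreducibles_span:
  assumes order: "monomial_order mle" and fin: "finite A" and v: "v \<in> A"
    and min: "\<And>s. s \<in> A \<Longrightarrow> mle v s"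
  defines "W \<equiv> {w \<in> A - {v}. v + w \<notin> (A - {v}) + (A - {v})}"
  shows "graded_exponent 1 ` A \<subseteq> span (graded_exponent 1 ` insert v W)"
proof -
  let ?g = "graded_exponent 1" and ?S = "span (graded_exponent 1 ` insert v W)"
  have gv: "?g v \<in> ?S" by (auto intro: span_base)
  have "?g s \<in> ?S" if "s \<in> A" for s
    using order fin _ that
  proof (rule monomial_order_finite_induct)
    fix s assume s: "s \<in> A" and IH: "\<And>t. t \<in> A \<Longrightarrow> mle t s \<Longrightarrow> t \<noteq> s \<Longrightarrow> ?g t \<in> ?S"
    show "?g s \<in> ?S"
    proof (cases "s = v \<or> s \<in> W")
      case True
      then show ?thesis by (auto intro: span_base)
    next
      case False
      then have "v + s \<in> (A - {v}) + (A - {v})" using s W_def by blast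
      then obtain a b where ab: "a \<in> A" "a \<noteq> v" "b \<in> A" "b \<noteq> v" "v + s = a + b"
        by (auto simp: set_plus_def)
      \<comment> \<open>Cancelling an element above \<open>v\<close> on one side leaves the other side below \<open>s\<close>.\<close>
      have below: "mle t s \<and> t \<noteq> s" if "u \<in> A" "u \<noteq> v" "v + s = u + t" for t u
      proof (rule ccontr)
        assume not_below: "\<not> (mle t s \<and> t \<noteq> s)"
        then have "mle s t"
          using order[THEN monomial_order_linorder]
          unfolding class.linorder_def class.linorder_axioms_def class.order_def class.preorder_def
          by metis
        then have st: "mle (v + s) (v + t)"
          using order unfolding monomial_order_def by (metis add.commute)
        have "mle (v + t) (u + t)" "v + t \<noteq> u + t"
          using monomial_order_add_strict[OF order min[OF that(1)], of t] that(2) by auto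
        then show False using st that(3) monomial_order_antisym[OF order] by metis
      qed
      have "?g a \<in> ?S" "?g b \<in> ?S"
        using IH below[OF ab(1,2,5)] below[OF ab(3,4)] ab by (auto simp: add.commute)
      moreover have "?g s = ?g a + ?g b - ?g v"
        using ab(5) graded_exponent_add[of 1 1 v s] graded_exponent_add[of 1 1 a b]
        by (simp add: algebra_simps)
      ultimately show ?thesis using gv by (simp add: span_add span_diff)
    qed
  qed
  then show ?thesis by blast
qed

text \<open>
  Remove the minimum \<open>v\<close> of \<open>A\<close>. The sums \<open>v + v\<close> and \<open>v + w\<close> with \<open>w\<close> irreducible are new, and by the
  previous lemma there are at least \<open>affine_rank A\<close> of them, which is enough if the rank does not
  drop. If it drops, then \<open>v\<close> is affinely independent of the rest, so that every \<open>w\<close> is irreducible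
  and \<open>card A\<close> sums are new.
\<close>

theorem freiman_inequality:
  fixes mle :: "('x::finite) mon \<Rightarrow> 'x mon \<Rightarrow> bool"
    and A :: "'x mon set"
  assumes order: "monomial_order mle" and fin: "finite A"
  shows "affine_rank A * card A \<le> card (A + A) + (affine_rank A choose 2)"
  using fin
proof (induction "card A" arbitrary: A rule: less_induct)
  case less
  let ?g = "graded_exponent 1 :: 'x mon \<Rightarrow> _"
  show ?case
  proof (cases "A = {}")
    case True
    then show ?thesis by simp
  next
    case False
    then obtain v where v: "v \<in> A" and min: "\<And>s. s \<in> A \<Longrightarrow> mle v s"
      using monomial_order_finite_minimum[OF order less.prems] by blast
    define A' where "A' = A - {v}"
    define W where "W = {w \<in> A'. v + w \<notin> A' + A'}"
    have A: "A = insert v A'" "v \<notin> A'" "finite A'" using v less.prems A'_def by auto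
    have card_A: "card A = Suc (card A')" using A by simp
    have IH: "affine_rank A' * card A' \<le> card (A' + A') + (affine_rank A' choose 2)"
      using less.hyps[of A'] A by simp
    have finW: "finite W" using A W_def by simp
    have v_double: "v + v \<notin> A' + A'"
    proof
      assume "v + v \<in> A' + A'"
      then obtain a b where ab: "a \<in> A'" "b \<in> A'" "v + v = a + b" by (auto simp: set_plus_def)
      have "mle (v + b) (a + b)" "v + b \<noteq> a + b"
        using monomial_order_add_strict[OF order min, of a b] ab A by auto
      moreover have "mle (v + v) (v + b)"
        using order min[of b] ab A unfolding monomial_order_def by (metis add.commute insertI2)
      ultimately show False using ab(3) monomial_order_antisym[OF order] by metis
    qed
    have "card (A' + A') + card ((+) v ` insert v W) = card ((A' + A') \<union> (+) v ` insert v W)"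
      using A finW v_double W_def by (intro card_Un_disjoint [symmetric]) (auto simp: finite_set_plus)
    also have "\<dots> \<le> card (A + A)"
      using A W_def by (intro card_mono) (auto simp: finite_set_plus intro: set_plus_intro elim!: set_plus_elim)
    finally have "card (A' + A') + card ((+) v ` insert v W) \<le> card (A + A)" .
    moreover have "card ((+) v ` insert v W) = card (insert v W)"
      by (rule card_image) (auto intro: inj_onI)
    moreover have "card (insert v W) = Suc (card W)"
      using finW A(2) by (simp add: W_def)
    ultimately have growth: "card (A' + A') + Suc (card W) \<le> card (A + A)"
      by simp
    have "affine_rank A \<le> dim (?g ` insert v W)"
      unfolding affine_rank_def
      using minimum_and_irreducibles_span[OF order less.prems v min] unfolding W_def A'_def
      by (metis (no_types, lifting) dim_span dim_subset)
    also have "\<dots> \<le> card (?g ` insert v W)" using finW by (intro dim_le_card') auto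
    also have "\<dots> \<le> Suc (card W)"
      using finW by (metis card_image_le card_insert_le_m1 card_insert_if finite_insert le_SucI le_trans order_refl)
    finally have rank_W: "affine_rank A \<le> Suc (card W)" .
    have rank: "affine_rank A = (if ?g v \<in> span (?g ` A') then affine_rank A' else Suc (affine_rank A'))"
      unfolding affine_rank_def A(1) by (simp add: dim_insert)
    show ?thesis
    proof (cases "?g v \<in> span (?g ` A')")
      case True
      then show ?thesis using rank rank_W IH growth card_A by auto
    next
      case False
      have "W = A'"
      proof -
        have "v + w \<notin> A' + A'" if "w \<in> A'" for w
        proof
          assume "v + w \<in> A' + A'"
          then obtain a b where ab: "a \<in> A'" "b \<in> A'" "v + w = a + b" by (auto simp: set_plus_def)
          have "?g v = ?g a + ?g b - ?g w"
            using ab(3) graded_exponent_add[of 1 1 v w] graded_exponent_add[of 1 1 a b]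
            by (simp add: algebra_simps)
          then show False using False ab that by (simp add: span_add span_diff span_base)
        qed
        then show ?thesis by (auto simp: W_def)
      qed
      moreover have "(Suc r choose 2) = r + (r choose 2)" for r
        by (simp add: numeral_2_eq_2)
      ultimately show ?thesis using rank False IH growth card_A by (simp add: algebra_simps)
    qed
  qed
qed

section \<open>Independent families and chains of prime ideals\<close>

lemma vector_space_of_ring_hom:
  fixes \<kappa> :: "'k::field \<Rightarrow> 'b::comm_ring_1"
  assumes "\<And>a b. \<kappa> (a + b) = \<kappa> a + \<kappa> b" "\<And>a b. \<kappa> (a * b) = \<kappa> a * \<kappa> b" "\<kappa> 1 = 1"
  shows "vector_space (\<lambda>c x. \<kappa> c * x)"
  by unfold_locales (simp_all add: assms algebra_simps)

text \<open>
  Independence is asked for only on subfamilies with nonzero coefficients. This is the form in which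
  it comes out of a chain of primes or of distinct initial monomials, and it includes injectivity.
\<close>

lemma (in vector_space) card_family_le:
  assumes "finite B" "finite J" and span: "\<And>i. i \<in> J \<Longrightarrow> y i \<in> span B"
    and nonzero: "\<And>E u. E \<subseteq> J \<Longrightarrow> E \<noteq> {} \<Longrightarrow> (\<And>i. i \<in> E \<Longrightarrow> u i \<noteq> 0) \<Longrightarrow>
          (\<Sum>i\<in>E. scale (u i) (y i)) \<noteq> 0"
  shows "card J \<le> card B"
proof -
  have inj: "inj_on y J"
  proof (rule inj_onI, rule ccontr)
    fix i j assume ij: "i \<in> J" "j \<in> J" "y i = y j" "i \<noteq> j"
    then have "(\<Sum>l\<in>{i, j}. scale (if l = i then 1 else - 1) (y l)) = 0" by simp
    moreover have "(\<Sum>l\<in>{i, j}. scale (if l = i then 1 else - 1) (y l)) \<noteq> 0"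
      using ij by (intro nonzero) auto
    ultimately show False by simp
  qed
  have "independent (y ` J)"
  proof (rule independent_if_scalars_zero)
    fix f x assume sum: "(\<Sum>x\<in>y ` J. scale (f x) x) = 0" and x: "x \<in> y ` J"
    define E where "E = {i \<in> J. f (y i) \<noteq> 0}"
    have "(\<Sum>i\<in>E. scale (f (y i)) (y i)) = (\<Sum>i\<in>J. scale (f (y i)) (y i))"
      using assms(2) unfolding E_def by (intro sum.mono_neutral_left) auto
    also have "\<dots> = 0" using sum inj by (simp add: sum.reindex)
    finally have "E = {}" using nonzero[of E "\<lambda>i. f (y i)"] E_def by blast
    then show "f x = 0" using x E_def by auto
  qed (use assms(2) in simp)
  then have "card (y ` J) \<le> card B"
    using independent_span_bound[OF assms(1)] span by blast
  then show ?thesis using inj by (simp add: card_image)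
qed

definition monomial_in :: "'a::comm_ring_1 list \<Rightarrow> nat list \<Rightarrow> 'a"
  where "monomial_in xs es = prod_list (map2 (^) xs es)"

lemma monomial_in_simps [simp]:
  "monomial_in [] es = 1"
  "monomial_in (x # xs) (e # es) = x ^ e * monomial_in xs es"
  by (simp_all add: monomial_in_def)

text \<open>
  The toric ring is not the universe of a type, so its prime ideals are described inside a subset of
  an ambient commutative ring.
\<close>

locale type_subring =
  fixes T :: "'a::comm_ring_1 set"
  assumes one_closed: "1 \<in> T"
    and add_closed: "a \<in> T \<Longrightarrow> b \<in> T \<Longrightarrow> a + b \<in> T"
    and uminus_closed: "a \<in> T \<Longrightarrow> - a \<in> T"
    and mult_closed: "a \<in> T \<Longrightarrow> b \<in> T \<Longrightarrow> a * b \<in> T"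
begin

lemma zero_closed: "0 \<in> T"
  using add_closed[OF one_closed uminus_closed[OF one_closed]] by simp

lemma power_closed: "a \<in> T \<Longrightarrow> a ^ n \<in> T"
  by (induction n) (auto intro: one_closed mult_closed)

lemma sum_closed: "(\<And>i. i \<in> E \<Longrightarrow> f i \<in> T) \<Longrightarrow> sum f E \<in> T"
  by (induction E rule: infinite_finite_induct) (auto intro: zero_closed add_closed)

lemma monomial_in_closed: "set xs \<subseteq> T \<Longrightarrow> monomial_in xs es \<in> T"
proof (induction xs arbitrary: es)
  case (Cons x xs)
  then show ?case
    by (cases es) (auto simp: monomial_in_def intro!: one_closed mult_closed power_closed)
qed (simp add: one_closed)

definition prime_in :: "'a set \<Rightarrow> bool"
  where "prime_in Q \<longleftrightarrow> Q \<subseteq> T \<and> 1 \<notin> Q \<and> 0 \<in> Q \<and> (\<forall>a\<in>Q. \<forall>b\<in>Q. a + b \<in> Q) \<and>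
    (\<forall>a\<in>T. \<forall>b\<in>Q. a * b \<in> Q) \<and> (\<forall>a\<in>T. \<forall>b\<in>T. a * b \<in> Q \<longrightarrow> a \<in> Q \<or> b \<in> Q)"

lemma prime_inD:
  assumes "prime_in Q"
  shows prime_in_subset: "a \<in> Q \<Longrightarrow> a \<in> T"
    and prime_in_one: "1 \<notin> Q"
    and prime_in_zero: "0 \<in> Q"
    and prime_in_add: "a \<in> Q \<Longrightarrow> b \<in> Q \<Longrightarrow> a + b \<in> Q"
    and prime_in_mult: "a \<in> T \<Longrightarrow> b \<in> Q \<Longrightarrow> a * b \<in> Q"
    and prime_in_cases: "a * b \<in> Q \<Longrightarrow> a \<in> T \<Longrightarrow> b \<in> T \<Longrightarrow> a \<in> Q \<or> b \<in> Q"
  using assms unfolding prime_in_def by blast+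

lemma prime_in_sum:
  "prime_in Q \<Longrightarrow> (\<And>i. i \<in> E \<Longrightarrow> f i \<in> Q) \<Longrightarrow> sum f E \<in> Q"
  by (induction E rule: infinite_finite_induct) (auto intro: prime_in_zero prime_in_add)

lemma prime_in_diff:
  assumes "prime_in Q" "a \<in> Q" "b \<in> Q"
  shows "a - b \<in> Q"
proof -
  have "- 1 * b \<in> Q"
    using assms(1) uminus_closed[OF one_closed] assms(3) by (rule prime_in_mult)
  then have "a + - 1 * b \<in> Q"
    by (rule prime_in_add[OF assms(1,2)])
  then show ?thesis by simp
qed

lemma prime_in_power:
  assumes "prime_in Q" "a \<in> T" "a \<notin> Q"
  shows "a ^ n \<notin> Q"
proof (induction n)
  case (Suc n)
  then show ?case
    using prime_in_cases[OF assms(1), of a "a ^ n"] assms power_closed by auto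
qed (simp add: prime_in_one[OF assms(1)])

lemma prime_in_unit:
  assumes "prime_in Q" "u * w = 1" "w \<in> T"
  shows "u \<notin> Q"
  using prime_in_mult[OF assms(1,3), of u] prime_in_one[OF assms(1)] assms(2)
  by (auto simp: mult.commute)

text \<open>
  This is the inequality between dimension and transcendence degree, in a form that avoids
  polynomials in several variables. The elements are any \<open>x\<^sub>i\<close> in the \<open>i\<close>-th prime but not in the one
  before it. In a relation modulo \<open>Q 0\<close>, the smallest power of \<open>x\<^sub>1\<close> can be cancelled because \<open>Q 0\<close> is
  prime; modulo \<open>Q 1\<close> the terms that still contain \<open>x\<^sub>1\<close> vanish, and what remains is a relation
  for the shorter chain. Coefficients are units, as are the nonzero scalars of an algebra over a
  field.
\<close>

theorem prime_chain_independent_monomials: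
  assumes "\<And>i. i \<le> c \<Longrightarrow> prime_in (Q i)" "\<And>i. i < c \<Longrightarrow> Q i \<subset> Q (Suc i)"
  shows "\<exists>xs. length xs = c \<and> set xs \<subseteq> T \<and>
    (\<forall>E u. finite E \<longrightarrow> E \<noteq> {} \<longrightarrow> E \<subseteq> {es. length es = c} \<longrightarrow>
      (\<forall>es\<in>E. u es \<in> T \<and> (\<exists>w\<in>T. u es * w = 1)) \<longrightarrow> (\<Sum>es\<in>E. u es * monomial_in xs es) \<notin> Q 0)"
  using assms
proof (induction c arbitrary: Q)
  case 0
  have "(\<Sum>es\<in>E. u es * monomial_in [] es) \<notin> Q 0"
    if "E \<noteq> {}" "E \<subseteq> {es. length es = 0}" "\<forall>es\<in>E. u es \<in> T \<and> (\<exists>w\<in>T. u es * w = 1)"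
    for E and u :: "nat list \<Rightarrow> 'a"
  proof -
    have "E = {[]}" using that(1,2) by auto
    then show ?thesis using that(3) prime_in_unit[OF 0(1)[of 0]] by auto
  qed
  then show ?case by (intro exI[of _ "[]"]) simp
next
  case (Suc c)
  note prime0 = Suc.prems(1)[of 0, simplified]
  have prime1: "prime_in (Q 1)" using Suc.prems(1)[of 1] by simp
  obtain xs where xs: "length xs = c" "set xs \<subseteq> T"
    and indep: "\<And>E u. finite E \<Longrightarrow> E \<noteq> {} \<Longrightarrow> E \<subseteq> {es. length es = c} \<Longrightarrow>
      (\<forall>es\<in>E. u es \<in> T \<and> (\<exists>w\<in>T. u es * w = 1)) \<Longrightarrow> (\<Sum>es\<in>E. u es * monomial_in xs es) \<notin> Q 1"
    using Suc.IH[of "\<lambda>i. Q (Suc i)"] Suc.prems by auto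
  obtain x where x: "x \<in> Q 1" "x \<notin> Q 0" using Suc.prems(2)[of 0] by auto
  have xT: "x \<in> T" using prime1 x(1) by (rule prime_in_subset)
  have "(\<Sum>es\<in>E. u es * monomial_in (x # xs) es) \<notin> Q 0"
    if E: "finite E" "E \<noteq> {}" "E \<subseteq> {es. length es = Suc c}"
      and u: "\<forall>es\<in>E. u es \<in> T \<and> (\<exists>w\<in>T. u es * w = 1)" for E u
  proof
    assume in_Q0: "(\<Sum>es\<in>E. u es * monomial_in (x # xs) es) \<in> Q 0"
    define j where "j = Min (hd ` E)"
    define F where "F = {es \<in> E. hd es = j}"
    define g where "g es = u es * (x ^ (hd es - j) * monomial_in xs (tl es))" for es
    have j_le: "j \<le> hd es" if "es \<in> E" for es using that E(1) j_def by simp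
    have gT: "g es \<in> T" if "es \<in> E" for es
      using that u xT xs(2) unfolding g_def
      by (intro mult_closed power_closed monomial_in_closed) auto
    have split: "u es * monomial_in (x # xs) es = x ^ j * g es" if "es \<in> E" for es
    proof -
      have "length es = Suc c" using that E(3) by auto
      then obtain e es' where es: "es = e # es'" by (cases es) auto
      have "x ^ e = x ^ j * x ^ (e - j)"
        using j_le[OF that] es by (simp flip: power_add)
      then show ?thesis by (simp add: g_def es mult_ac)
    qed
    have "x ^ j * (\<Sum>es\<in>E. g es) \<in> Q 0"
      using in_Q0 split by (simp add: sum_distrib_left cong: sum.cong)
    then have "(\<Sum>es\<in>E. g es) \<in> Q 0"
      using prime_in_cases[OF prime0 _ power_closed[OF xT] sum_closed[of E g, OF gT]]
        prime_in_power[OF prime0 xT x(2), of j] by blast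
    then have "(\<Sum>es\<in>E. g es) \<in> Q 1" using Suc.prems(2)[of 0] by auto
    moreover have "(\<Sum>es\<in>E - F. g es) \<in> Q 1"
    proof (rule prime_in_sum[OF prime1])
      fix es assume es: "es \<in> E - F"
      then obtain k where k: "hd es - j = Suc k"
        using j_le[of es] F_def by (metis (mono_tags, lifting) DiffE Suc_diff_Suc le_neq_implies_less mem_Collect_eq)
      have "g es = (u es * (x ^ k * monomial_in xs (tl es))) * x"
        unfolding g_def k by (simp add: mult_ac)
      moreover have "u es * (x ^ k * monomial_in xs (tl es)) \<in> T"
        using es u xT xs(2) by (intro mult_closed power_closed monomial_in_closed) auto
      ultimately show "g es \<in> Q 1" using prime_in_mult[OF prime1 _ x(1)] by simp
    qed
    moreover have "(\<Sum>es\<in>E. g es) = (\<Sum>es\<in>E - F. g es) + (\<Sum>es\<in>F. g es)"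
      using E(1) by (intro sum.subset_diff) (auto simp: F_def)
    ultimately have "(\<Sum>es\<in>F. g es) \<in> Q 1"
      using prime_in_diff[OF prime1, of "\<Sum>es\<in>E. g es" "\<Sum>es\<in>E - F. g es"] by simp
    moreover have "(\<Sum>es\<in>F. g es) = (\<Sum>es\<in>tl ` F. u (j # es) * monomial_in xs es)"
    proof -
      have cons: "es = j # tl es" if "es \<in> F" for es
        using that E(3) F_def by (cases es) auto
      then have "inj_on tl F" by (metis inj_onI)
      then show ?thesis
        by (simp add: sum.reindex g_def F_def) (intro sum.cong, use cons F_def in auto)
    qed
    moreover have "(\<Sum>es\<in>tl ` F. u (j # es) * monomial_in xs es) \<notin> Q 1"
    proof (rule indep)
      have "j \<in> hd ` E" unfolding j_def using E by (intro Min_in) auto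
      then show "tl ` F \<noteq> {}" by (auto simp: F_def)
      show "\<forall>es\<in>tl ` F. u (j # es) \<in> T \<and> (\<exists>w\<in>T. u (j # es) * w = 1)"
      proof
        fix es assume "es \<in> tl ` F"
        then obtain es' where es': "es' \<in> E" "hd es' = j" "es = tl es'" by (auto simp: F_def)
        moreover have "es' \<noteq> []" using es'(1) E(3) by auto
        ultimately have "j # es \<in> E" by auto
        then show "u (j # es) \<in> T \<and> (\<exists>w\<in>T. u (j # es) * w = 1)" using u by blast
      qed
    qed (use E in \<open>auto simp: F_def\<close>)
    ultimately show False by simp
  qed
  then show ?case using xs xT by (intro exI[of _ "x # xs"]) auto
qed

end


section \<open>Ideals as spans\<close>

text \<open>
  A commutative ring is a module over itself, its submodules are its ideals, and the span of a set
  is the ideal that it generates.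
\<close>

interpretation rmod: Modules.module "(*) :: 'a::comm_ring_1 \<Rightarrow> 'a \<Rightarrow> 'a"
  by unfold_locales (simp_all add: algebra_simps)

\<comment> \<open>Reassociates products to the left, so it loops with the rules for commutative rings.\<close>
declare rmod.scale_scale [simp del]

lemma ring_of_type_algebra_simps [simp]:
  "carrier ring_of_type_algebra = UNIV"
  "x \<otimes>\<^bsub>ring_of_type_algebra\<^esub> y = x * y"
  "x \<oplus>\<^bsub>ring_of_type_algebra\<^esub> y = x + y"
  "\<one>\<^bsub>ring_of_type_algebra\<^esub> = 1"
  "\<zero>\<^bsub>ring_of_type_algebra\<^esub> = 0"
  by (simp_all add: ring_of_type_algebra_def)

lemma ideal_iff_subspace:
  fixes I :: "'a::comm_ring_1 set"
  shows "ideal I ring_of_type_algebra \<longleftrightarrow> rmod.subspace I"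
proof
  assume I: "ideal I ring_of_type_algebra"
  interpret ideal I "ring_of_type_algebra :: 'a ring" by fact
  show "rmod.subspace I"
  proof (rule rmod.subspaceI)
    show "0 \<in> I" using additive_subgroup.zero_closed[OF ideal.axioms(1)[OF I]] by simp
    show "x + y \<in> I" if "x \<in> I" "y \<in> I" for x y using additive_subgroup.a_closed[OF ideal.axioms(1)[OF I] that] by simp
    show "c * x \<in> I" if "x \<in> I" for c x using I_l_closed[OF that, of c] by simp
  qed
next
  assume I: "rmod.subspace I"
  interpret ring "ring_of_type_algebra :: 'a ring" by (rule ring_from_type_algebra)
  show "ideal I ring_of_type_algebra"
  proof (rule idealI)
    have minus: "\<ominus>\<^bsub>ring_of_type_algebra\<^esub> a = - a" for a :: 'a
      by (rule minus_equality) auto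
    show "subgroup I (add_monoid ring_of_type_algebra)"
    proof (rule add.subgroupI)
      show "I \<noteq> {}" using rmod.subspace_0[OF I] by blast
      show "\<ominus>\<^bsub>ring_of_type_algebra\<^esub> a \<in> I" if "a \<in> I" for a
        using rmod.subspace_neg[OF I that] by (simp add: minus)
      show "a \<oplus>\<^bsub>ring_of_type_algebra\<^esub> b \<in> I" if "a \<in> I" "b \<in> I" for a b
        using rmod.subspace_add[OF I that] by simp
    qed simp
    show "x \<otimes>\<^bsub>ring_of_type_algebra\<^esub> a \<in> I" "a \<otimes>\<^bsub>ring_of_type_algebra\<^esub> x \<in> I" if "a \<in> I" for a x
      using rmod.subspace_scale[OF I that, of x] by (simp_all add: mult.commute)
  qed (rule ring_axioms)
qed

lemma genideal_eq_span:
  fixes B :: "'a::comm_ring_1 set"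
  shows "Idl\<^bsub>ring_of_type_algebra\<^esub> B = rmod.span B"
  unfolding genideal_def ideal_iff_subspace rmod.span_def hull_def by auto

lemma ideal_prod_span:
  fixes B C :: "'a::comm_ring_1 set"
  shows "rmod.span B \<cdot>\<^bsub>ring_of_type_algebra\<^esub> rmod.span C = rmod.span {b * c | b c. b \<in> B \<and> c \<in> C}"
    (is "?P = rmod.span ?BC")
proof
  have product: "x * y \<in> rmod.span ?BC" if x: "x \<in> rmod.span B" and y: "y \<in> rmod.span C" for x y
    using x
  proof (induction rule: rmod.span_induct_alt)
    case (step c b z)
    have "b * y \<in> rmod.span ?BC"
      using y
    proof (induction rule: rmod.span_induct_alt)
      case (step d c z)
      have "b * c \<in> ?BC" using step(1) \<open>b \<in> B\<close> by blast
      then have "d * (b * c) \<in> rmod.span ?BC"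
        by (intro rmod.span_scale rmod.span_base)
      then have "d * (b * c) + b * z \<in> rmod.span ?BC"
        using step(2) by (rule rmod.span_add)
      moreover have "b * (d * c + z) = d * (b * c) + b * z" by (simp add: algebra_simps)
      ultimately show ?case by (simp only:)
    qed (simp add: rmod.span_zero)
    then have "c * (b * y) + z * y \<in> rmod.span ?BC"
      using step(2) by (intro rmod.span_add[OF rmod.span_scale])
    moreover have "(c * b + z) * y = c * (b * y) + z * y" by (simp add: algebra_simps)
    ultimately show ?case by (simp only:)
  qed (simp add: rmod.span_zero)
  show "?P \<subseteq> rmod.span ?BC"
  proof
    fix x assume "x \<in> ?P"
    then show "x \<in> rmod.span ?BC"
      by induction (auto intro: product rmod.span_add)
  qed
  interpret ring "ring_of_type_algebra :: 'a ring" by (rule ring_from_type_algebra)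
  have "rmod.subspace ?P"
    using ideal_prod_is_ideal[of "rmod.span B" "rmod.span C"] by (simp add: ideal_iff_subspace)
  moreover have "?BC \<subseteq> ?P"
    using ideal_prod.prod[of _ "rmod.span B" _ "rmod.span C" ring_of_type_algebra]
    by (auto intro: rmod.span_base)
  ultimately show "rmod.span ?BC \<subseteq> ?P" by (rule rmod.span_minimal[rotated])
qed

lemma mem_coset_iff:
  fixes a x :: "'a::comm_ring_1"
  shows "x \<in> I +>\<^bsub>ring_of_type_algebra\<^esub> a \<longleftrightarrow> x - a \<in> I"
  unfolding a_r_coset_def' by (auto intro!: bexI[of _ "_ - a"])

lemma coset_eq_iff:
  fixes a b :: "'a::comm_ring_1"
  assumes I: "rmod.subspace I"
  shows "I +>\<^bsub>ring_of_type_algebra\<^esub> a = I +>\<^bsub>ring_of_type_algebra\<^esub> b \<longleftrightarrow> a - b \<in> I"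
proof
  assume eq: "I +>\<^bsub>ring_of_type_algebra\<^esub> a = I +>\<^bsub>ring_of_type_algebra\<^esub> b"
  have "a \<in> I +>\<^bsub>ring_of_type_algebra\<^esub> a" using rmod.subspace_0[OF I] by (simp add: mem_coset_iff)
  then show "a - b \<in> I" unfolding eq mem_coset_iff .
next
  assume ab: "a - b \<in> I"
  have "x - a \<in> I \<longleftrightarrow> x - b \<in> I" for x
    using rmod.subspace_add[OF I _ ab, of "x - a"] rmod.subspace_diff[OF I _ ab, of "x - b"] by auto
  then show "I +>\<^bsub>ring_of_type_algebra\<^esub> a = I +>\<^bsub>ring_of_type_algebra\<^esub> b"
    by (intro Set.set_eqI) (simp only: mem_coset_iff)
qed

lemma ideal_power_0: "ideal_power L 0 = UNIV"
  by (simp add: ideal_power_def nat_pow_def ideals_set_def)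

lemma ideal_power_Suc: "ideal_power L (Suc k) = ideal_power L k \<cdot>\<^bsub>polyring\<^esub> L"
  by (simp add: ideal_power_def nat_pow_def ideals_set_def)

section \<open>Polynomials as sums of terms\<close>

lemma sum_of_terms:
  fixes f :: "'a \<Rightarrow>\<^sub>0 'b::comm_monoid_add"
  shows "f = (\<Sum>s\<in>Poly_Mapping.keys f. Poly_Mapping.single s (Poly_Mapping.lookup f s))"
proof (rule poly_mapping_eqI)
  fix t
  have "(\<Sum>s\<in>Poly_Mapping.keys f. Poly_Mapping.lookup f s when s = t) = Poly_Mapping.lookup f t"
    by (simp add: when_def in_keys_iff)
  then show "Poly_Mapping.lookup f t =
      Poly_Mapping.lookup (\<Sum>s\<in>Poly_Mapping.keys f. Poly_Mapping.single s (Poly_Mapping.lookup f s)) t"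
    by (simp add: lookup_sum lookup_single)
qed

lemma single_eq_const_mult:
  "Poly_Mapping.single s c = Poly_Mapping.single 0 c * (mon_poly s :: ('x::finite, 'k::field) mpol)"
  by (simp add: mon_poly_def mult_single)

lemma mon_poly_add: "mon_poly (s + t) = mon_poly s * mon_poly t"
  by (simp add: mon_poly_def mult_single)

lemma mon_poly_0: "mon_poly 0 = 1"
  by (simp add: mon_poly_def)

text \<open>
  The quotient by the irrelevant ideal is the field: only constant coefficients survive modulo
  \<open>\<mm>L\<^sup>k\<close>.
\<close>

lemma nonconstant_part_in_irrelevant_ideal:
  "f - Poly_Mapping.single 0 (Poly_Mapping.lookup f 0) \<in> irrelevant_ideal"
proof -
  let ?m = "irrelevant_ideal :: ('a, 'b) mpol set"
  let ?t = "\<lambda>s. Poly_Mapping.single s (Poly_Mapping.lookup f s)"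
  have subspace: "rmod.subspace ?m"
    by (simp add: irrelevant_ideal_def genideal_eq_span)
  have term_in: "Poly_Mapping.single s c \<in> ?m" if "s \<noteq> 0" for s c
  proof -
    obtain x where x: "Poly_Mapping.lookup s x \<noteq> 0"
      using \<open>s \<noteq> 0\<close> by (metis lookup_zero poly_mapping_eqI)
    have "s = (s - Poly_Mapping.single x 1) + Poly_Mapping.single x 1"
      by (rule poly_mapping_eqI) (use x in \<open>auto simp: lookup_add lookup_minus lookup_single when_def\<close>)
    then have "Poly_Mapping.single s c =
        Poly_Mapping.single (s - Poly_Mapping.single x 1) c * mon_poly (Poly_Mapping.single x 1)"
      by (simp add: mon_poly_def mult_single)
    moreover have "mon_poly (Poly_Mapping.single x 1) \<in> ?m"
      by (simp add: irrelevant_ideal_def genideal_eq_span rmod.span_base)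
    ultimately show ?thesis using rmod.subspace_scale[OF subspace] by metis
  qed
  have "f = (\<Sum>s\<in>Poly_Mapping.keys f - {0}. ?t s) + ?t 0"
  proof (cases "0 \<in> Poly_Mapping.keys f")
    case True
    then show ?thesis
      using sum_of_terms[of f] sum.remove[of "Poly_Mapping.keys f" 0 ?t] by (simp add: add.commute)
  next
    case False
    then show ?thesis using sum_of_terms[of f] by (simp add: in_keys_iff)
  qed
  then have "f - ?t 0 = (\<Sum>s\<in>Poly_Mapping.keys f - {0}. ?t s)"
    by (rule diff_eq_eq[THEN iffD2])
  also have "\<dots> \<in> ?m" using subspace term_in by (intro rmod.subspace_sum) auto
  finally show ?thesis .
qed

section \<open>Powers of monomial ideals\<close>

primrec fold_sumset :: "'a::monoid_add set \<Rightarrow> nat \<Rightarrow> 'a set"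
  where "fold_sumset A 0 = {0}"
  | "fold_sumset A (Suc k) = fold_sumset A k + A"

lemma fold_sumset_add:
  "s \<in> fold_sumset A k \<Longrightarrow> t \<in> fold_sumset A l \<Longrightarrow> s + t \<in> fold_sumset A (k + l)"
proof (induction l arbitrary: t)
  case (Suc l)
  then obtain u a where "t = u + a" "u \<in> fold_sumset A l" "a \<in> A"
    by (auto elim: set_plus_elim)
  then show ?case using Suc by (simp add: set_plus_intro flip: add.assoc)
qed simp

lemma finite_fold_sumset: "finite A \<Longrightarrow> finite (fold_sumset A k)"
  by (induction k) (auto simp: finite_set_plus)

lemma products_of_monomials:
  "{b * c |b c. b \<in> mon_poly ` S \<and> c \<in> mon_poly ` T} = (mon_poly ` (S + T) :: ('x::finite, 'k::field) mpol set)"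
proof (intro equalityI subsetI)
  fix f :: "('x, 'k) mpol"
  assume "f \<in> {b * c |b c. b \<in> mon_poly ` S \<and> c \<in> mon_poly ` T}"
  then obtain s t where "f = mon_poly (s + t)" "s \<in> S" "t \<in> T"
    by (auto simp: mon_poly_add)
  then show "f \<in> mon_poly ` (S + T)" by blast
next
  fix f :: "('x, 'k) mpol"
  assume "f \<in> mon_poly ` (S + T)"
  then obtain s t where "f = mon_poly s * mon_poly t" "s \<in> S" "t \<in> T"
    by (auto simp: mon_poly_add elim!: set_plus_elim)
  then show "f \<in> {b * c |b c. b \<in> mon_poly ` S \<and> c \<in> mon_poly ` T}" by blast
qed

lemma ideal_power_monomials:
  fixes A :: "('x::finite) mon set"
  shows "ideal_power (rmod.span (mon_poly ` A) :: ('x, 'k::field) mpol set) k =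
    rmod.span (mon_poly ` fold_sumset A k)"
proof (induction k)
  case 0
  have "f \<in> rmod.span {1}" for f :: "('x, 'k) mpol"
    using rmod.span_scale[OF rmod.span_base[of 1 "{1}"], of f] by simp
  then show ?case by (auto simp: ideal_power_0 mon_poly_0)
next
  case (Suc k)
  show ?case
    unfolding ideal_power_Suc Suc.IH ideal_prod_span products_of_monomials by simp
qed

lemma mem_span_monomials:
  fixes f :: "('x::finite, 'k::field) mpol"
  assumes "Poly_Mapping.keys f \<subseteq> A"
  shows "f \<in> rmod.span (mon_poly ` A)"
proof -
  have "Poly_Mapping.single 0 (Poly_Mapping.lookup f s) * mon_poly s \<in> rmod.span (mon_poly ` A)"
    if "s \<in> Poly_Mapping.keys f" for s
    using that assms by (intro rmod.span_scale rmod.span_base) auto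
  then have "(\<Sum>s\<in>Poly_Mapping.keys f. Poly_Mapping.single s (Poly_Mapping.lookup f s)) \<in>
      rmod.span (mon_poly ` A)"
    unfolding mon_poly_def by (intro rmod.span_sum) (simp add: mult_single)
  then show ?thesis by (simp flip: sum_of_terms)
qed

section \<open>The toric ring over the fiber ring of a monomial ideal\<close>

text \<open>
  The algebra \<open>K[x\<^sup>a t | a \<in> A]\<close>, as a subring of the polynomials in \<open>t\<close> over \<open>K[x\<^sub>1, \<dots>, x\<^sub>n]\<close>. It maps
  onto the fiber ring of the ideal generated by the monomials in \<open>A\<close>, which gives the upper bound on
  the dimension of the fiber ring.
\<close>

definition toric_ring :: "('x::finite) mon set \<Rightarrow> ('x, 'k::field) mpol poly set"
  where "toric_ring A = {p. \<forall>k. Poly_Mapping.keys (coeff p k) \<subseteq> fold_sumset A k}"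

definition toric_scalar :: "'k::field \<Rightarrow> ('x::finite, 'k) mpol poly"
  where "toric_scalar c = [:Poly_Mapping.single 0 c:]"

lemma keys_mult_subset:
  fixes f g :: "('x::finite, 'k::field) mpol"
  assumes "Poly_Mapping.keys f \<subseteq> S" "Poly_Mapping.keys g \<subseteq> T"
  shows "Poly_Mapping.keys (f * g) \<subseteq> S + T"
  using keys_mult[of f g] assms by (fastforce intro: set_plus_intro)

interpretation toric: type_subring "toric_ring A :: ('x::finite, 'k::field) mpol poly set" for A
proof
  show "1 \<in> toric_ring A"
    by (auto simp: toric_ring_def one_pCons coeff_pCons split: nat.splits)
  show "a + b \<in> toric_ring A" if "a \<in> toric_ring A" "b \<in> toric_ring A" for a b :: "('x, 'k) mpol poly"
    using that Poly_Mapping.keys_add unfolding toric_ring_def by fastforce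
  show "- a \<in> toric_ring A" if "a \<in> toric_ring A" for a :: "('x, 'k) mpol poly"
    using that unfolding toric_ring_def by (simp add: in_keys_iff subset_iff)
  show "a * b \<in> toric_ring A" if ab: "a \<in> toric_ring A" "b \<in> toric_ring A" for a b :: "('x, 'k) mpol poly"
    unfolding toric_ring_def
  proof (intro CollectI allI subsetI)
    fix k s
    assume "s \<in> Poly_Mapping.keys (coeff (a * b) k)"
    then have "s \<in> (\<Union>i\<in>{..k}. Poly_Mapping.keys (coeff a i * coeff b (k - i)))"
      unfolding coeff_mult by (rule subsetD[OF Poly_Mapping.keys_sum])
    then obtain i where i: "i \<le> k" "s \<in> Poly_Mapping.keys (coeff a i * coeff b (k - i))" by auto
    have "Poly_Mapping.keys (coeff a i) \<subseteq> fold_sumset A i"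
      "Poly_Mapping.keys (coeff b (k - i)) \<subseteq> fold_sumset A (k - i)"
      using ab by (simp_all add: toric_ring_def)
    from subsetD[OF keys_mult_subset[OF this] i(2)]
    have "s \<in> fold_sumset A i + fold_sumset A (k - i)" .
    then show "s \<in> fold_sumset A k"
      using i(1) fold_sumset_add[of _ A i _ "k - i"] by (auto elim!: set_plus_elim)
  qed
qed

lemma toric_scalar_in: "toric_scalar c \<in> toric_ring A"
  by (auto simp: toric_ring_def toric_scalar_def coeff_pCons split: nat.splits if_splits)

lemma toric_scalar_hom:
  "toric_scalar (a + b) = toric_scalar a + toric_scalar b"
  "toric_scalar (a * b) = toric_scalar a * toric_scalar b"
  "toric_scalar 1 = 1"
  by (simp_all add: toric_scalar_def single_add mult_single mult.commute)

text \<open>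
  On the toric ring this is a homomorphism onto the fiber ring. Elsewhere the coefficient of \<open>t\<^sup>k\<close>
  need not lie in \<open>L\<^sup>k\<close>.
\<close>

definition fiber_class :: "('x::finite, 'k::field) mpol set \<Rightarrow> ('x, 'k) mpol poly \<Rightarrow> nat \<Rightarrow> ('x, 'k) mpol set"
  where "fiber_class L p k = fiber_mod L k +>\<^bsub>polyring\<^esub> coeff p k"

context
  fixes A :: "('x::finite) mon set" and L :: "('x, 'k::field) mpol set"
  assumes L: "L = rmod.span (mon_poly ` A)"
begin

lemma power_eq: "ideal_power L k = rmod.span (mon_poly ` fold_sumset A k)"
  unfolding L by (rule ideal_power_monomials)

lemma coeff_in_power: "p \<in> toric_ring A \<Longrightarrow> coeff p k \<in> ideal_power L k"
  unfolding power_eq toric_ring_def by (auto intro: mem_span_monomials)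

lemma power_mult: "f \<in> ideal_power L i \<Longrightarrow> g \<in> ideal_power L j \<Longrightarrow> f * g \<in> ideal_power L (i + j)"
proof -
  assume fg: "f \<in> ideal_power L i" "g \<in> ideal_power L j"
  have "fold_sumset A i + fold_sumset A j \<subseteq> fold_sumset A (i + j)"
    using fold_sumset_add[of _ A i _ j] by (auto elim!: set_plus_elim)
  then have "ideal_power L i \<cdot>\<^bsub>polyring\<^esub> ideal_power L j \<subseteq> ideal_power L (i + j)"
    unfolding power_eq ideal_prod_span products_of_monomials by (intro rmod.span_mono image_mono)
  then show ?thesis using ideal_prod.prod[OF fg, of polyring] by auto
qed

lemma fiber_mod_subspace: "rmod.subspace (fiber_mod L k)"
  unfolding fiber_mod_def power_eq irrelevant_ideal_def genideal_eq_span ideal_prod_span by simp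

lemma fiber_mod_subset: "fiber_mod L k \<subseteq> ideal_power L k"
proof
  fix f assume "f \<in> fiber_mod L k"
  then show "f \<in> ideal_power L k"
    unfolding fiber_mod_def
    by induction (auto simp: power_eq intro: rmod.span_scale rmod.span_add)
qed

lemma fiber_mod_mult:
  assumes "f \<in> fiber_mod L i" and g: "g \<in> ideal_power L j"
  shows "f * g \<in> fiber_mod L (i + j)"
  using assms(1) unfolding fiber_mod_def
proof induction
  case (prod u p)
  then show ?case
    using ideal_prod.prod[OF prod(1) power_mult[OF prod(2) g], of polyring] by (simp add: mult.assoc)
next
  case (sum f1 f2)
  then show ?case
    using ideal_prod.sum[OF sum.IH] by (simp add: algebra_simps)
qed

text \<open>
  Surjectivity in each degree: a combination of generators of \<open>L\<^sup>k\<close> changes by an element of \<open>\<mm>L\<^sup>k\<close>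
  when its coefficients are replaced by their constant terms.
\<close>

lemma power_representative:
  assumes "f \<in> ideal_power L k"
  shows "\<exists>g. Poly_Mapping.keys g \<subseteq> fold_sumset A k \<and> f - g \<in> fiber_mod L k"
  using assms unfolding power_eq
proof (induction rule: rmod.span_induct_alt)
  case base
  show ?case using rmod.subspace_0[OF fiber_mod_subspace] by (intro exI[of _ 0]) simp
next
  case (step h b f)
  then obtain g where g: "Poly_Mapping.keys g \<subseteq> fold_sumset A k" "f - g \<in> fiber_mod L k" by blast
  obtain s where s: "s \<in> fold_sumset A k" "b = mon_poly s" using step by blast
  let ?h0 = "Poly_Mapping.lookup h 0"
  have "(h - Poly_Mapping.single 0 ?h0) * b \<in> fiber_mod L k"
    using ideal_prod.prod[OF nonconstant_part_in_irrelevant_ideal[of h], of b "ideal_power L k" polyring]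
    unfolding fiber_mod_def by (simp add: power_eq s rmod.span_base)
  then have "(h - Poly_Mapping.single 0 ?h0) * b + (f - g) \<in> fiber_mod L k"
    using g(2) by (rule rmod.subspace_add[OF fiber_mod_subspace])
  moreover have "(h - Poly_Mapping.single 0 ?h0) * b + (f - g) = h * b + f - (Poly_Mapping.single s ?h0 + g)"
    unfolding single_eq_const_mult[of s] s(2) by (simp add: algebra_simps)
  moreover have "Poly_Mapping.keys (Poly_Mapping.single s ?h0 + g) \<subseteq> fold_sumset A k"
    using Poly_Mapping.keys_add[of "Poly_Mapping.single s ?h0" g] g(1) s(1) by (auto split: if_splits)
  ultimately show ?case by (intro exI[of _ "Poly_Mapping.single s ?h0 + g"]) simp
qed

lemma coset_zero: "fiber_mod L k +>\<^bsub>polyring\<^esub> 0 = fiber_mod L k"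
  by (auto simp: mem_coset_iff)

lemma fiber_class_in_carrier:
  assumes "p \<in> toric_ring A"
  shows "fiber_class L p \<in> carrier (fiber_ring L)"
proof -
  have "{k. fiber_class L p k \<noteq> fiber_mod L k} \<subseteq> {..degree p}"
    using coeff_eq_0[of p] coset_zero unfolding fiber_class_def by (auto simp: not_less[symmetric])
  then have "finite {k. fiber_class L p k \<noteq> fiber_mod L k}" by (rule finite_subset) simp
  then show ?thesis
    using coeff_in_power[OF assms] unfolding fiber_ring_def by (auto simp: fiber_class_def)
qed

lemma fiber_class_surj:
  assumes "f \<in> carrier (fiber_ring L)"
  obtains p where "p \<in> toric_ring A" "fiber_class L p = f"
proof -
  have f: "f k \<in> (\<lambda>a. fiber_mod L k +>\<^bsub>polyring\<^esub> a) ` ideal_power L k" for k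
    using assms by (simp add: fiber_ring_def)
  have fin: "finite {k. f k \<noteq> fiber_mod L k}"
    using assms by (simp add: fiber_ring_def)
  have "\<exists>g. Poly_Mapping.keys g \<subseteq> fold_sumset A k \<and> f k = fiber_mod L k +>\<^bsub>polyring\<^esub> g \<and>
      (f k = fiber_mod L k \<longrightarrow> g = 0)" for k
  proof (cases "f k = fiber_mod L k")
    case True
    then show ?thesis using coset_zero by (intro exI[of _ 0]) simp
  next
    case False
    obtain a where a: "a \<in> ideal_power L k" "f k = fiber_mod L k +>\<^bsub>polyring\<^esub> a" using f by blast
    then show ?thesis
      using power_representative[OF a(1)] coset_eq_iff[OF fiber_mod_subspace] False by metis
  qed
  then obtain g where g: "\<And>k. Poly_Mapping.keys (g k) \<subseteq> fold_sumset A k"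
    "\<And>k. f k = fiber_mod L k +>\<^bsub>polyring\<^esub> g k" "\<And>k. f k = fiber_mod L k \<Longrightarrow> g k = 0"
    by metis
  define p where "p = (\<Sum>k\<in>{k. f k \<noteq> fiber_mod L k}. monom (g k) k)"
  have coeff_p: "coeff p k = g k" for k
    using fin g(3) unfolding p_def by (auto simp: coeff_sum)
  show ?thesis
  proof
    show "p \<in> toric_ring A" using g(1) by (simp add: toric_ring_def coeff_p)
    show "fiber_class L p = f" using g(2) by (auto simp: fiber_class_def coeff_p)
  qed
qed

lemma fiber_class_one: "fiber_class L 1 = \<one>\<^bsub>fiber_ring L\<^esub>"
  by (rule ext) (auto simp: fiber_class_def fiber_ring_def one_pCons coeff_pCons coset_zero split: nat.splits)

lemma fiber_class_zero: "fiber_class L 0 = \<zero>\<^bsub>fiber_ring L\<^esub>"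
  by (auto simp: fiber_class_def fiber_ring_def coset_zero)

lemma fiber_mod_ideal: "ideal (fiber_mod L k) polyring"
  using fiber_mod_subspace by (simp add: ideal_iff_subspace)

lemma fiber_class_add: "fiber_class L (p + q) = fiber_class L p \<oplus>\<^bsub>fiber_ring L\<^esub> fiber_class L q"
proof
  fix k
  interpret ideal "fiber_mod L k" polyring by (rule fiber_mod_ideal)
  show "fiber_class L (p + q) k = (fiber_class L p \<oplus>\<^bsub>fiber_ring L\<^esub> fiber_class L q) k"
    by (simp add: fiber_class_def fiber_ring_def a_rcos_sum)
qed

text \<open>
  The product of cosets does not depend on the representatives because \<open>\<mm>L\<^sup>i L\<^sup>j\<close> and \<open>L\<^sup>i \<mm>L\<^sup>j\<close>
  are contained in \<open>\<mm>L\<^sup>i\<^sup>+\<^sup>j\<close>.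
\<close>

lemma rcoset_mult_fiber:
  assumes f: "f \<in> ideal_power L i" and g: "g \<in> ideal_power L j" and k: "k = i + j"
  shows "rcoset_mult polyring (fiber_mod L k) (fiber_mod L i +>\<^bsub>polyring\<^esub> f) (fiber_mod L j +>\<^bsub>polyring\<^esub> g) =
    fiber_mod L k +>\<^bsub>polyring\<^esub> (f * g)"
proof -
  have product: "fiber_mod L k +>\<^bsub>polyring\<^esub> (a * b) = fiber_mod L k +>\<^bsub>polyring\<^esub> (f * g)"
    if a: "a \<in> fiber_mod L i +>\<^bsub>polyring\<^esub> f" and b: "b \<in> fiber_mod L j +>\<^bsub>polyring\<^esub> g" for a b
  proof -
    have af: "a - f \<in> fiber_mod L i" and bg: "b - g \<in> fiber_mod L j"
      using a b by (simp_all add: mem_coset_iff)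
    have "b \<in> ideal_power L j"
      using rmod.span_add[of "b - g" "mon_poly ` fold_sumset A j" g] bg g fiber_mod_subset[of j]
      unfolding power_eq by auto
    then have "(a - f) * b \<in> fiber_mod L (i + j)" by (rule fiber_mod_mult[OF af])
    moreover have "(b - g) * f \<in> fiber_mod L (j + i)" by (rule fiber_mod_mult[OF bg f])
    ultimately have "(a - f) * b + (b - g) * f \<in> fiber_mod L k"
      unfolding k using rmod.subspace_add[OF fiber_mod_subspace] by (simp add: add.commute)
    moreover have "(a - f) * b + (b - g) * f = a * b - f * g" by (simp add: algebra_simps)
    ultimately show ?thesis by (simp add: coset_eq_iff[OF fiber_mod_subspace])
  qed
  let ?F = "fiber_mod L i +>\<^bsub>polyring\<^esub> f" and ?G = "fiber_mod L j +>\<^bsub>polyring\<^esub> g"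
  have nonempty: "f \<in> ?F" "g \<in> ?G"
    by (simp_all add: mem_coset_iff rmod.subspace_0[OF fiber_mod_subspace])
  have "rcoset_mult polyring (fiber_mod L k) ?F ?G = (\<Union>a\<in>?F. \<Union>b\<in>?G. fiber_mod L k +>\<^bsub>polyring\<^esub> (f * g))"
    unfolding rcoset_mult_def ring_of_type_algebra_simps by (intro SUP_cong refl product)
  also have "\<dots> = fiber_mod L k +>\<^bsub>polyring\<^esub> (f * g)"
    using nonempty by (subst SUP_const, blast)+ (rule refl)
  finally show ?thesis .
qed

lemma fiber_class_mult:
  assumes p: "p \<in> toric_ring A" and q: "q \<in> toric_ring A"
  shows "fiber_class L (p * q) = fiber_class L p \<otimes>\<^bsub>fiber_ring L\<^esub> fiber_class L q"
proof
  fix k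
  let ?M = "fiber_mod L k" and ?t = "\<lambda>i. coeff p i * coeff q (k - i)"
  interpret ideal ?M polyring by (rule fiber_mod_ideal)
  interpret hom: ring_hom_ring polyring "polyring Quot ?M" "(+>\<^bsub>polyring\<^esub>) ?M"
    by (rule rcos_ring_hom_ring)
  have finsum: "(\<Oplus>\<^bsub>polyring\<^esub>i\<in>E. h i) = sum h E" if "finite E" for h :: "nat \<Rightarrow> ('x, 'k) mpol" and E
    using that by (induction E rule: finite_induct) auto
  have "(fiber_class L p \<otimes>\<^bsub>fiber_ring L\<^esub> fiber_class L q) k =
      (\<Oplus>\<^bsub>polyring Quot ?M\<^esub>i\<in>{..k}. rcoset_mult polyring ?M (fiber_class L p i) (fiber_class L q (k - i)))"
    by (simp add: fiber_ring_def)
  also have "\<dots> = (\<Oplus>\<^bsub>polyring Quot ?M\<^esub>i\<in>{..k}. ?M +>\<^bsub>polyring\<^esub> ?t i)"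
  proof (rule hom.S.finsum_cong')
    show "(\<lambda>i. ?M +>\<^bsub>polyring\<^esub> ?t i) \<in> {..k} \<rightarrow> carrier (polyring Quot ?M)"
      by (intro funcsetI hom.hom_closed) simp
    show "rcoset_mult polyring ?M (fiber_class L p i) (fiber_class L q (k - i)) = ?M +>\<^bsub>polyring\<^esub> ?t i"
      if "i \<in> {..k}" for i
      unfolding fiber_class_def using that coeff_in_power[OF p] coeff_in_power[OF q]
      by (intro rcoset_mult_fiber) auto
  qed simp
  also have "\<dots> = ?M +>\<^bsub>polyring\<^esub> (\<Oplus>\<^bsub>polyring\<^esub>i\<in>{..k}. ?t i)"
    by (subst hom.hom_finsum) (auto simp: o_def)
  also have "\<dots> = fiber_class L (p * q) k"
    by (simp add: finsum fiber_class_def coeff_mult)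
  finally show "fiber_class L (p * q) k = (fiber_class L p \<otimes>\<^bsub>fiber_ring L\<^esub> fiber_class L q) k" by simp
qed

text \<open>
  That the fiber ring is a commutative ring is part of what it means for \<open>P\<close> to be a prime ideal.
\<close>

lemma prime_in_pullback:
  assumes "primeideal P (fiber_ring L)"
  shows "toric.prime_in A {p \<in> toric_ring A. fiber_class L p \<in> P}"
proof -
  interpret primeideal P "fiber_ring L" by fact
  have one: "\<one>\<^bsub>fiber_ring L\<^esub> \<notin> P" using I_notcarr one_imp_carrier by blast
  show ?thesis
    unfolding toric.prime_in_def
  proof (intro conjI ballI impI)
    show "0 \<in> {p \<in> toric_ring A. fiber_class L p \<in> P}"
      using additive_subgroup.zero_closed[OF is_additive_subgroup]
      by (simp add: toric.zero_closed fiber_class_zero)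
    show "1 \<notin> {p \<in> toric_ring A. fiber_class L p \<in> P}" using one by (simp add: fiber_class_one)
    show "a + b \<in> {p \<in> toric_ring A. fiber_class L p \<in> P}"
      if "a \<in> {p \<in> toric_ring A. fiber_class L p \<in> P}" "b \<in> {p \<in> toric_ring A. fiber_class L p \<in> P}" for a b
      using that additive_subgroup.a_closed[OF is_additive_subgroup]
      by (simp add: toric.add_closed fiber_class_add)
    show "a * b \<in> {p \<in> toric_ring A. fiber_class L p \<in> P}"
      if "a \<in> toric_ring A" "b \<in> {p \<in> toric_ring A. fiber_class L p \<in> P}" for a b
      using that I_l_closed fiber_class_in_carrier[of a]
      by (simp add: toric.mult_closed fiber_class_mult)
    show "a \<in> {p \<in> toric_ring A. fiber_class L p \<in> P} \<or> b \<in> {p \<in> toric_ring A. fiber_class L p \<in> P}"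
      if "a \<in> toric_ring A" "b \<in> toric_ring A" "a * b \<in> {p \<in> toric_ring A. fiber_class L p \<in> P}" for a b
      using that I_prime[OF fiber_class_in_carrier[of a] fiber_class_in_carrier[of b]]
      by (auto simp: fiber_class_mult)
  qed auto
qed

lemma pullback_strict:
  assumes "primeideal P' (fiber_ring L)" "P \<subset> P'"
  shows "{p \<in> toric_ring A. fiber_class L p \<in> P} \<subset> {p \<in> toric_ring A. fiber_class L p \<in> P'}"
proof -
  interpret primeideal P' "fiber_ring L" by fact
  obtain f where f: "f \<in> P'" "f \<notin> P" using assms(2) by blast
  then have "f \<in> carrier (fiber_ring L)" using a_subset by blast
  then obtain p where "p \<in> toric_ring A" "fiber_class L p = f" by (rule fiber_class_surj)
  then show ?thesis using f assms(2) by blast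
qed

end

section \<open>Growth of the toric ring\<close>

text \<open>
  A coordinate that does not vanish on \<open>V\<close> cuts out a subspace of smaller dimension.
\<close>

lemma separating_coordinates:
  fixes V :: "'b::euclidean_space set"
  assumes "subspace V"
  obtains J where "J \<subseteq> Basis" "card J \<le> dim V"
    "\<And>x y. x \<in> V \<Longrightarrow> y \<in> V \<Longrightarrow> (\<And>b. b \<in> J \<Longrightarrow> x \<bullet> b = y \<bullet> b) \<Longrightarrow> x = y"
proof -
  have "\<exists>J\<subseteq>Basis. card J \<le> dim V \<and> (\<forall>x\<in>V. (\<forall>b\<in>J. x \<bullet> b = 0) \<longrightarrow> x = 0)"
    using assms
  proof (induction "dim V" arbitrary: V rule: less_induct)
    case less
    show ?case
    proof (cases "V \<subseteq> {0}")
      case True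
      then show ?thesis by (intro exI[of _ "{}"]) auto
    next
      case False
      then obtain x where x: "x \<in> V" "x \<noteq> 0" by auto
      then obtain b where b: "b \<in> Basis" "x \<bullet> b \<noteq> 0" using euclidean_all_zero_iff by blast
      define V' where "V' = V \<inter> {y. y \<bullet> b = 0}"
      have "subspace {y. y \<bullet> b = 0}"
        by (simp add: subspace_def inner_add_left)
      then have V': "subspace V'"
        unfolding V'_def using less.prems by (rule subspace_inter[rotated])
      have "V' \<subset> V" using x b V'_def by auto
      then have lt: "dim V' < dim V"
        using V' less.prems by (intro dim_psubset) (simp add: span_eq_iff[THEN iffD2])
      then obtain J where J: "J \<subseteq> Basis" "card J \<le> dim V'"
        "\<forall>x\<in>V'. (\<forall>b\<in>J. x \<bullet> b = 0) \<longrightarrow> x = 0"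
        using less.hyps V' by blast
      have "finite J" using J(1) finite_subset finite_Basis by blast
      then have "card (insert b J) \<le> dim V" using J(2) lt by (simp add: card_insert_if)
      then show ?thesis using J b V'_def by (intro exI[of _ "insert b J"]) auto
    qed
  qed
  then obtain J where J: "J \<subseteq> Basis" "card J \<le> dim V" "\<forall>x\<in>V. (\<forall>b\<in>J. x \<bullet> b = 0) \<longrightarrow> x = 0"
    by blast
  show ?thesis
  proof (rule that[OF J(1,2)])
    fix x y assume "x \<in> V" "y \<in> V" "\<And>b. b \<in> J \<Longrightarrow> x \<bullet> b = y \<bullet> b"
    then show "x = y" using J(3) subspace_diff[OF assms, of x y] by (auto simp: inner_diff_left)
  qed
qed

lemma exponent_le_of_power_bound:
  fixes c r M :: nat
  assumes "\<And>m. (m + 1) ^ c \<le> (M * m + 1) ^ r"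
  shows "c \<le> r"
proof (rule ccontr)
  assume "\<not> c \<le> r"
  then obtain k where k: "c = r + Suc k" using less_imp_Suc_add by (metis add_Suc_right not_le_imp_less)
  \<comment> \<open>With this value the factor \<open>m + 1\<close> outweighs the constant \<open>(M + 1)\<^sup>r\<close>.\<close>
  define m where "m = (M + 1) ^ r"
  have "(m + 1) ^ r * (m + 1) \<le> (m + 1) ^ c"
    unfolding k power_add using self_le_power[of "m + 1" "Suc k"] by (intro mult_le_mono order_refl) simp_all
  also have "\<dots> \<le> (M * m + 1) ^ r" by (rule assms)
  also have "\<dots> \<le> ((M + 1) * (m + 1)) ^ r" by (intro power_mono) (auto simp: algebra_simps)
  also have "\<dots> = (m + 1) ^ r * m" unfolding power_mult_distrib by (subst m_def) simp
  finally show False by simp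
qed

lemma graded_exponent_in_span:
  "s \<in> fold_sumset A k \<Longrightarrow> graded_exponent k s \<in> span (graded_exponent 1 ` A)"
proof (induction k arbitrary: s)
  case 0
  then have "graded_exponent 0 s = 0"
    by (simp add: graded_exponent_def zero_prod_def vec_eq_iff)
  then show ?case by (simp add: span_zero)
next
  case (Suc k)
  then obtain t a where ta: "s = t + a" "t \<in> fold_sumset A k" "a \<in> A"
    by (auto elim: set_plus_elim)
  then have "graded_exponent (Suc k) s = graded_exponent k t + graded_exponent 1 a"
    using graded_exponent_add[of k 1 t a] by simp
  then show ?case using Suc.IH ta by (simp add: span_add span_base)
qed

lemma lookup_fold_sumset_le:
  assumes "\<And>a. a \<in> A \<Longrightarrow> Poly_Mapping.lookup a x \<le> M"
  shows "s \<in> fold_sumset A k \<Longrightarrow> Poly_Mapping.lookup s x \<le> M * k"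
proof (induction k arbitrary: s)
  case (Suc k)
  then obtain t a where ta: "s = t + a" "t \<in> fold_sumset A k" "a \<in> A"
    by (auto elim: set_plus_elim)
  then show ?case using Suc.IH[of t] assms[of a] by (simp add: lookup_add)
qed simp

text \<open>
  The exponents of the toric ring lie in a space of dimension \<open>affine_rank A\<close>, so that as many of
  their coordinates determine them. Up to degree \<open>n\<close> each coordinate is a natural number at most
  \<open>M n\<close>.
\<close>

lemma card_graded_exponents_le:
  fixes A :: "('x::finite) mon set"
  assumes "finite A"
  obtains M where "\<And>n. card (SIGMA k:{..n}. fold_sumset A k) \<le> (M * n + 1) ^ affine_rank A"
proof -
  let ?V = "span (graded_exponent 1 ` A)"
  obtain J where J: "J \<subseteq> Basis" "card J \<le> dim ?V"
    and separates: "\<And>x y. x \<in> ?V \<Longrightarrow> y \<in> ?V \<Longrightarrow> (\<And>b. b \<in> J \<Longrightarrow> x \<bullet> b = y \<bullet> b) \<Longrightarrow> x = y"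
    using separating_coordinates[OF subspace_span] by blast
  have finJ: "finite J" using J(1) finite_subset finite_Basis by blast
  \<comment> \<open>The summand 1 makes \<open>M k\<close> also a bound for the degree coordinate \<open>k\<close>.\<close>
  define M where "M = 1 + (\<Sum>a\<in>A. \<Sum>x\<in>UNIV. Poly_Mapping.lookup a x)"
  have M: "Poly_Mapping.lookup a x \<le> M" if "a \<in> A" for a x
  proof -
    have "Poly_Mapping.lookup a x \<le> (\<Sum>x\<in>UNIV. Poly_Mapping.lookup a x)"
      by (rule member_le_sum) auto
    also have "\<dots> \<le> (\<Sum>a\<in>A. \<Sum>x\<in>UNIV. Poly_Mapping.lookup a x)"
      using that assms by (intro member_le_sum[of a A "\<lambda>a. \<Sum>x\<in>UNIV. Poly_Mapping.lookup a x"]) auto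
    finally show ?thesis by (simp add: M_def)
  qed
  have coordinate: "\<exists>c\<le>M * k. graded_exponent k s \<bullet> b = real c" if "s \<in> fold_sumset A k" "b \<in> Basis" for k s b
  proof -
    have "k \<le> M * k" by (simp add: M_def)
    then show ?thesis
      using that(2) lookup_fold_sumset_le[OF M that(1)]
      by (auto simp: Basis_prod_def Basis_vec_def graded_exponent_def inner_axis)
  qed
  have "card (SIGMA k:{..n}. fold_sumset A k) \<le> (M * n + 1) ^ affine_rank A" for n
  proof -
    define g where "g = (\<lambda>(k, s). restrict (\<lambda>b. nat \<lfloor>graded_exponent k s \<bullet> b\<rfloor>) J)"
    have "inj_on g (SIGMA k:{..n}. fold_sumset A k)"
    proof (rule inj_onI, clarify)
      fix k s l t
      assume s: "s \<in> fold_sumset A k" and t: "t \<in> fold_sumset A l" and eq: "g (k, s) = g (l, t)"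
      have "graded_exponent k s \<bullet> b = graded_exponent l t \<bullet> b" if "b \<in> J" for b
      proof -
        have b: "b \<in> Basis" using that J(1) by blast
        have "nat \<lfloor>graded_exponent k s \<bullet> b\<rfloor> = nat \<lfloor>graded_exponent l t \<bullet> b\<rfloor>"
          using fun_cong[OF eq, of b] that by (simp add: g_def)
        moreover obtain c where "graded_exponent k s \<bullet> b = real c" using coordinate[OF s b] by blast
        moreover obtain d where "graded_exponent l t \<bullet> b = real d" using coordinate[OF t b] by blast
        ultimately show ?thesis by simp
      qed
      then have "graded_exponent k s = graded_exponent l t"
        by (intro separates graded_exponent_in_span s t)
      then show "k = l \<and> s = t" by simp
    qed
    moreover have "g ` (SIGMA k:{..n}. fold_sumset A k) \<subseteq> J \<rightarrow>\<^sub>E {..M * n}"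
    proof (clarify)
      fix k s assume ks: "k \<le> n" "s \<in> fold_sumset A k"
      have "nat \<lfloor>graded_exponent k s \<bullet> b\<rfloor> \<le> M * n" if "b \<in> J" for b
      proof -
        have "b \<in> Basis" using that J(1) by blast
        then obtain c where c: "c \<le> M * k" "graded_exponent k s \<bullet> b = real c"
          using coordinate[OF ks(2)] by blast
        have "c \<le> M * n" using c(1) mult_le_mono2[OF ks(1)] by (rule order.trans)
        then show ?thesis using c(2) by simp
      qed
      then show "g (k, s) \<in> J \<rightarrow>\<^sub>E {..M * n}" by (auto simp: g_def)
    qed
    ultimately have "card (SIGMA k:{..n}. fold_sumset A k) \<le> card (J \<rightarrow>\<^sub>E {..M * n})"
      using finJ by (intro card_inj_on_le[of g]) (auto intro: finite_PiE)
    also have "\<dots> = (M * n + 1) ^ card J" using finJ by (simp add: card_funcsetE)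
    also have "\<dots> \<le> (M * n + 1) ^ affine_rank A"
      using J(2) by (intro power_increasing) (auto simp: affine_rank_def dim_span)
    finally show ?thesis .
  qed
  then show ?thesis by (rule that)
qed

section \<open>The analytic spread of a monomial ideal\<close>

lemma degree_monomial_in_le:
  fixes xs :: "'a::comm_ring_1 poly list"
  assumes "\<And>x. x \<in> set xs \<Longrightarrow> degree x \<le> N" "\<And>e. e \<in> set es \<Longrightarrow> e \<le> m"
  shows "degree (monomial_in xs es) \<le> N * m * length xs"
  using assms
proof (induction xs arbitrary: es)
  case (Cons x xs)
  show ?case
  proof (cases es)
    case (Cons e es')
    have "degree (x ^ e) \<le> N * m"
      using degree_power_le[of x e] mult_le_mono[of "degree x" N e m] Cons.prems Cons by auto
    moreover have "degree (monomial_in xs es') \<le> N * m * length xs"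
      using Cons.IH[of es'] Cons.prems Cons by simp
    ultimately show ?thesis
      using degree_mult_le[of "x ^ e" "monomial_in xs es'"] Cons by simp
  qed (simp add: monomial_in_def)
qed simp

interpretation toric_space: vector_space "\<lambda>c (p :: ('x::finite, 'k::field) mpol poly). toric_scalar c * p"
  by (rule vector_space_of_ring_hom) (fact toric_scalar_hom)+

lemma toric_ring_span:
  fixes p :: "('x::finite, 'k::field) mpol poly"
  assumes p: "p \<in> toric_ring A" and "degree p \<le> n"
  shows "p \<in> toric_space.span ((\<lambda>(k, s). monom (mon_poly s) k) ` (SIGMA k:{..n}. fold_sumset A k))"
    (is "_ \<in> toric_space.span ?B")
proof -
  have "monom (coeff p k) k \<in> toric_space.span ?B" if "k \<le> n" for k
  proof -
    have keys: "Poly_Mapping.keys (coeff p k) \<subseteq> fold_sumset A k" using p by (simp add: toric_ring_def)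
    have "toric_scalar (Poly_Mapping.lookup (coeff p k) s) * monom (mon_poly s) k \<in> toric_space.span ?B"
      if "s \<in> Poly_Mapping.keys (coeff p k)" for s
      using that keys \<open>k \<le> n\<close> by (intro toric_space.span_scale toric_space.span_base) force
    then have "(\<Sum>s\<in>Poly_Mapping.keys (coeff p k).
        monom (Poly_Mapping.single s (Poly_Mapping.lookup (coeff p k) s)) k) \<in> toric_space.span ?B"
      by (intro toric_space.span_sum)
        (simp add: toric_scalar_def smult_monom mon_poly_def mult_single)
    then show ?thesis by (simp add: monom_sum[symmetric] sum_of_terms[symmetric])
  qed
  then have "(\<Sum>k\<le>degree p. monom (coeff p k) k) \<in> toric_space.span ?B"
    using assms(2) by (intro toric_space.span_sum) auto
  then show ?thesis by (simp add: poly_as_sum_of_monoms)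
qed

text \<open>
  The \<open>(m + 1)\<^sup>c\<close> monomials in \<open>c\<close> elements of the toric ring with exponents up to \<open>m\<close> are linearly
  independent, and their degrees are bounded by a multiple of \<open>m\<close>. The elements of such degrees span
  a space whose dimension grows at most like \<open>m\<close> to the power \<open>affine_rank A\<close>.
\<close>

lemma prime_chain_length_le:
  fixes Q :: "nat \<Rightarrow> ('x::finite, 'k::field) mpol poly set"
  assumes "finite A" and prime: "\<And>i. i \<le> c \<Longrightarrow> toric.prime_in A (Q i)"
    and strict: "\<And>i. i < c \<Longrightarrow> Q i \<subset> Q (Suc i)"
  shows "c \<le> affine_rank A"
proof -
  obtain xs where xs: "length xs = c" "set xs \<subseteq> toric_ring A"
    and indep: "\<And>E u. finite E \<Longrightarrow> E \<noteq> {} \<Longrightarrow> E \<subseteq> {es. length es = c} \<Longrightarrow>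
      (\<forall>es\<in>E. u es \<in> toric_ring A \<and> (\<exists>w\<in>toric_ring A. u es * w = 1)) \<Longrightarrow>
      (\<Sum>es\<in>E. u es * monomial_in xs es) \<notin> Q 0"
    using toric.prime_chain_independent_monomials[of c A Q] prime strict by blast
  obtain M where M: "\<And>n. card (SIGMA k:{..n}. fold_sumset A k) \<le> (M * n + 1) ^ affine_rank A"
    using card_graded_exponents_le[OF assms(1)] by blast
  define N where "N = Max (insert 0 (degree ` set xs))"
  have N: "degree x \<le> N" if "x \<in> set xs" for x using that by (simp add: N_def)
  have "(m + 1) ^ c \<le> ((M * N * c) * m + 1) ^ affine_rank A" for m
  proof -
    let ?J = "{es. set es \<subseteq> {..m} \<and> length es = c}"
    let ?G = "SIGMA k:{..N * m * c}. fold_sumset A k"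
    let ?B = "(\<lambda>(k, s). monom (mon_poly s) k) ` ?G :: ('x, 'k) mpol poly set"
    have finG: "finite ?G" using finite_fold_sumset[OF assms(1)] by blast
    have finJ: "finite ?J" by (rule finite_lists_length_eq) simp
    have "card ?J \<le> card ?B"
    proof (rule toric_space.card_family_le[of _ _ "monomial_in xs"])
      show "monomial_in xs es \<in> toric_space.span ?B" if "es \<in> ?J" for es
        using degree_monomial_in_le[of xs N es m] N xs that
        by (intro toric_ring_span toric.monomial_in_closed) auto
      show "(\<Sum>es\<in>E. toric_scalar (u es) * monomial_in xs es) \<noteq> 0"
        if E: "E \<subseteq> ?J" "E \<noteq> {}" and u: "\<And>es. es \<in> E \<Longrightarrow> u es \<noteq> 0" for E and u :: "nat list \<Rightarrow> 'k"
      proof -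
        have "toric_scalar (u es) * toric_scalar (inverse (u es)) = (1 :: ('x, 'k) mpol poly)" if "es \<in> E" for es
          using u[OF that] by (simp add: toric_scalar_hom flip: toric_scalar_hom(2))
        then have "(\<Sum>es\<in>E. toric_scalar (u es) * monomial_in xs es) \<notin> Q 0"
          using E finite_subset[OF E(1) finJ] toric_scalar_in by (intro indep) blast+
        then show ?thesis using toric.prime_in_zero[OF prime[of 0]] by auto
      qed
    qed (use finG finJ in auto)
    also have "card ?B \<le> card ?G" by (rule card_image_le[OF finG])
    also have "\<dots> \<le> (M * (N * m * c) + 1) ^ affine_rank A" by (rule M)
    finally show ?thesis by (simp add: card_lists_length_eq mult_ac)
  qed
  then show ?thesis by (rule exponent_le_of_power_bound)
qed

text \<open>
  Chains of primes of the fiber ring pull back to the toric ring. An upper bound is what the main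
  inequality requires, because its right-hand side increases with the analytic spread as long as
  this is at most \<open>card A\<close>.
\<close>

theorem analytic_spread_le_affine_rank:
  fixes A :: "('x::finite) mon set"
  assumes "finite A"
  shows "analytic_spread (Idl\<^bsub>polyring\<^esub> (mon_poly ` A) :: ('x, 'k::field) mpol set) \<le> affine_rank A"
proof -
  let ?L = "Idl\<^bsub>polyring\<^esub> (mon_poly ` A) :: ('x, 'k) mpol set"
  have L: "?L = rmod.span (mon_poly ` A)" by (rule genideal_eq_span)
  have "krull_dim (fiber_ring ?L) \<le> enat (affine_rank A)"
    unfolding krull_dim_def
  proof (rule Sup_least, clarify)
    fix c P
    assume "\<forall>i\<le>c. primeideal (P i) (fiber_ring ?L)" "\<forall>i<c. P i \<subset> P (Suc i)"
    then have "c \<le> affine_rank A"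
      using prime_in_pullback[OF L] pullback_strict[OF L]
      by (intro prime_chain_length_le[OF assms, of c "\<lambda>i. {p \<in> toric_ring A. fiber_class ?L p \<in> P i}"]) auto
    then show "enat c \<le> enat (affine_rank A)" by simp
  qed
  then show ?thesis unfolding analytic_spread_def by (cases "krull_dim (fiber_ring ?L)") auto
qed

section \<open>Degrees and homogeneous components\<close>

lemma mon_deg_add: "mon_deg (s + t) = mon_deg s + mon_deg t"
  by (simp add: mon_deg_def lookup_add sum.distrib)

lemma mon_deg_eq_0_iff: "mon_deg s = 0 \<longleftrightarrow> s = 0"
  by (auto simp: mon_deg_def intro: poly_mapping_eqI)

lemma finite_mon_deg: "finite {s :: ('x::finite) mon. mon_deg s = d}"
proof (rule inj_on_finite[of Poly_Mapping.lookup])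
  show "inj_on Poly_Mapping.lookup {s :: 'x mon. mon_deg s = d}"
    by (rule inj_onI) (simp only: Poly_Mapping.lookup_inject)
  show "Poly_Mapping.lookup ` {s :: 'x mon. mon_deg s = d} \<subseteq> UNIV \<rightarrow>\<^sub>E {..d}"
  proof (intro image_subsetI PiE_I)
    fix s :: "'x mon" and x assume "s \<in> {s. mon_deg s = d}"
    moreover have "Poly_Mapping.lookup s x \<le> mon_deg s"
      unfolding mon_deg_def by (rule member_le_sum) simp_all
    ultimately show "Poly_Mapping.lookup s x \<in> {..d}" by simp
  qed simp
  show "finite ((UNIV :: 'x set) \<rightarrow>\<^sub>E {..d})" by (rule finite_PiE) auto
qed

text \<open>
  Applied to the monomials of degree at least \<open>e\<close> and to the multiples of given monomials.
\<close>

lemma subspace_keys_upward_closed: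
  assumes "\<And>s t. s \<in> U \<Longrightarrow> s + t \<in> U"
  shows "rmod.subspace {f :: ('x::finite, 'k::field) mpol. Poly_Mapping.keys f \<subseteq> U}"
proof (rule rmod.subspaceI)
  show "f + g \<in> {f. Poly_Mapping.keys f \<subseteq> U}"
    if "f \<in> {f. Poly_Mapping.keys f \<subseteq> U}" "g \<in> {f. Poly_Mapping.keys f \<subseteq> U}" for f g :: "('x, 'k) mpol"
    using that Poly_Mapping.keys_add[of f g] by blast
  show "h * f \<in> {f. Poly_Mapping.keys f \<subseteq> U}"
    if "f \<in> {f. Poly_Mapping.keys f \<subseteq> U}" for h f :: "('x, 'k) mpol"
  proof
    have "Poly_Mapping.keys (h * f) \<subseteq> UNIV + U" using that by (intro keys_mult_subset) auto
    also have "\<dots> \<subseteq> U"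
    proof
      fix s assume "s \<in> UNIV + U"
      then obtain t u where "s = u + t" "u \<in> U" by (auto elim: set_plus_elim simp: add.commute)
      then show "s \<in> U" using assms by simp
    qed
    finally show "Poly_Mapping.keys (h * f) \<subseteq> U" .
  qed
qed simp

lemma subspace_min_degree:
  "rmod.subspace {f :: ('x::finite, 'k::field) mpol. Poly_Mapping.keys f \<subseteq> {s. e \<le> mon_deg s}}"
  by (rule subspace_keys_upward_closed) (simp add: mon_deg_add)

lemma keys_multiple_of_monomials:
  assumes "(f :: ('x::finite, 'k::field) mpol) \<in> rmod.span (mon_poly ` M)" "s \<in> Poly_Mapping.keys f"
  obtains t u where "t \<in> M" "s = t + u"
proof -
  let ?U = "{t + u | t u. t \<in> M}"
  have "rmod.span (mon_poly ` M) \<subseteq> {f :: ('x, 'k) mpol. Poly_Mapping.keys f \<subseteq> ?U}"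
  proof (rule rmod.span_minimal)
    show "rmod.subspace {f :: ('x, 'k) mpol. Poly_Mapping.keys f \<subseteq> ?U}"
      by (rule subspace_keys_upward_closed) (use add.assoc in blast)
    have "t \<in> ?U" if "t \<in> M" for t
      using that add_0_right[of t, symmetric] by blast
    then show "mon_poly ` M \<subseteq> {f :: ('x, 'k) mpol. Poly_Mapping.keys f \<subseteq> ?U}"
      by (auto simp: mon_poly_def)
  qed
  then show ?thesis using assms that by blast
qed

lemma lookup_hom_component:
  "Poly_Mapping.lookup (hom_component d f) s = (if mon_deg s = d then Poly_Mapping.lookup f s else 0)"
proof -
  have "Poly_Mapping.lookup (hom_component d f) s =
      (\<Sum>t\<in>{t \<in> Poly_Mapping.keys f. mon_deg t = d}. Poly_Mapping.lookup f t when t = s)"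
    by (simp add: hom_component_def lookup_sum lookup_single)
  then show ?thesis by (simp add: when_def in_keys_iff)
qed

lemma keys_hom_component:
  "Poly_Mapping.keys (hom_component d f) = {s \<in> Poly_Mapping.keys f. mon_deg s = d}"
  by (auto simp: in_keys_iff lookup_hom_component split: if_splits)

lemma homogeneous_hom_component: "homogeneous d (hom_component d f)"
  by (simp add: homogeneous_def keys_hom_component)

lemma hom_component_homogeneous: "homogeneous d f \<Longrightarrow> hom_component d f = f"
  by (rule poly_mapping_eqI) (auto simp: lookup_hom_component homogeneous_def in_keys_iff)

lemma hom_component_add: "hom_component d (f + g) = hom_component d f + hom_component d g"
  by (rule poly_mapping_eqI) (simp add: lookup_hom_component lookup_add)

lemma homogeneous_mult:
  assumes "homogeneous d f" "homogeneous e g"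
  shows "homogeneous (d + e) (f * g)"
  using Poly_Mapping.keys_mult[of f g] assms unfolding homogeneous_def by (fastforce simp: mon_deg_add)

lemma lookup_const_mult:
  "Poly_Mapping.lookup (Poly_Mapping.single 0 c * f) s = c * (Poly_Mapping.lookup f s :: 'k::field)"
  by (simp add: mult_map_scale_conv_mult[symmetric] Poly_Mapping.map.rep_eq when_def)

interpretation mpol_space: vector_space "\<lambda>c (f :: ('x::finite, 'k::field) mpol). Poly_Mapping.single 0 c * f"
  by (rule vector_space_of_ring_hom) (simp_all add: single_add mult_single)

text \<open>
  In the lowest degree of an ideal, multiplication by a polynomial is multiplication by its constant
  term. This turns ideal generators into linear ones.
\<close>

lemma hom_component_mult_min_degree:
  fixes f h :: "('x::finite, 'k::field) mpol"
  assumes f: "Poly_Mapping.keys f \<subseteq> {s. e \<le> mon_deg s}"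
  shows "hom_component e (h * f) = Poly_Mapping.single 0 (Poly_Mapping.lookup h 0) * hom_component e f"
proof -
  let ?c = "Poly_Mapping.single 0 (Poly_Mapping.lookup h 0)"
  have "Poly_Mapping.keys (g * f) \<subseteq> {s. Suc e \<le> mon_deg s}" if "g \<in> irrelevant_ideal" for g
    using that unfolding irrelevant_ideal_def genideal_eq_span
  proof (induction rule: rmod.span_induct_alt)
    case (step c b g)
    then obtain x where b: "b = mon_poly (Poly_Mapping.single x 1)" by blast
    have "Poly_Mapping.keys b \<subseteq> {s. 1 \<le> mon_deg s}"
      by (auto simp: b mon_poly_def mon_deg_def lookup_single when_def)
    then have "Poly_Mapping.keys (b * f) \<subseteq> {s. 1 \<le> mon_deg s} + {s. e \<le> mon_deg s}"
      using f by (rule keys_mult_subset)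
    also have "\<dots> \<subseteq> {s. Suc e \<le> mon_deg s}" by (auto elim!: set_plus_elim simp: mon_deg_add)
    finally have "b * f \<in> {f. Poly_Mapping.keys f \<subseteq> {s. Suc e \<le> mon_deg s}}" by simp
    then have "c * (b * f) \<in> {f. Poly_Mapping.keys f \<subseteq> {s. Suc e \<le> mon_deg s}}"
      by (rule rmod.subspace_scale[OF subspace_min_degree])
    then have "c * (b * f) + g * f \<in> {f. Poly_Mapping.keys f \<subseteq> {s. Suc e \<le> mon_deg s}}"
      by (rule rmod.subspace_add[OF subspace_min_degree]) (use step(2) in simp)
    moreover have "(c * b + g) * f = c * (b * f) + g * f" by (simp add: algebra_simps)
    ultimately show ?case by simp
  qed simp
  from this[OF nonconstant_part_in_irrelevant_ideal[of h]]
  have "hom_component e ((h - ?c) * f) = 0"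
    by (intro poly_mapping_eqI) (auto simp: lookup_hom_component in_keys_iff)
  moreover have "h * f = ?c * f + (h - ?c) * f" by (simp add: algebra_simps)
  moreover have "hom_component e (?c * f) = ?c * hom_component e f"
    by (rule poly_mapping_eqI) (simp add: lookup_hom_component lookup_const_mult)
  ultimately show ?thesis by (simp add: hom_component_add)
qed

section \<open>Initial monomials\<close>

lemma initial_monI:
  assumes "monomial_order mle" "s \<in> Poly_Mapping.keys f" "\<And>t. t \<in> Poly_Mapping.keys f \<Longrightarrow> mle t s"
  shows "initial_mon mle f = s"
  unfolding initial_mon_def using assms(2,3) monomial_order_antisym[OF assms(1)] by (intro the_equality) auto

lemma initial_mon_max:
  assumes order: "monomial_order mle" and "f \<noteq> 0"
  shows "initial_mon mle f \<in> Poly_Mapping.keys f"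
    and "t \<in> Poly_Mapping.keys f \<Longrightarrow> mle t (initial_mon mle f)"
proof -
  interpret linorder mle "\<lambda>s t. mle s t \<and> s \<noteq> t" using order by (rule monomial_order_linorder)
  have "Poly_Mapping.keys f \<noteq> {}" using \<open>f \<noteq> 0\<close> by (auto simp: in_keys_iff intro: poly_mapping_eqI)
  then have "Max (Poly_Mapping.keys f) \<in> Poly_Mapping.keys f"
    "\<And>t. t \<in> Poly_Mapping.keys f \<Longrightarrow> mle t (Max (Poly_Mapping.keys f))" by simp_all
  moreover from this have "initial_mon mle f = Max (Poly_Mapping.keys f)" by (rule initial_monI[OF order])
  ultimately show "initial_mon mle f \<in> Poly_Mapping.keys f"
    and "t \<in> Poly_Mapping.keys f \<Longrightarrow> mle t (initial_mon mle f)" by simp_all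
qed

lemma initial_mon_mult:
  fixes f g :: "('x::finite, 'k::field) mpol"
  assumes order: "monomial_order mle" and "f \<noteq> 0" "g \<noteq> 0"
  shows "f * g \<noteq> 0" "initial_mon mle (f * g) = initial_mon mle f + initial_mon mle g"
proof -
  let ?s = "initial_mon mle f" and ?t = "initial_mon mle g"
  let ?a = "Poly_Mapping.lookup f ?s" and ?b = "Poly_Mapping.lookup g ?t"
  let ?f' = "f - Poly_Mapping.single ?s ?a" and ?g' = "g - Poly_Mapping.single ?t ?b"
  note f = initial_mon_max[OF order \<open>f \<noteq> 0\<close>] and g = initial_mon_max[OF order \<open>g \<noteq> 0\<close>]
  have add_mono: "mle (u + v) (u' + v')" if "mle u u'" "mle v v'" for u u' v v'
  proof -
    interpret linorder mle "\<lambda>s t. mle s t \<and> s \<noteq> t" using order by (rule monomial_order_linorder)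
    have "mle (u + v) (u' + v)" using order that(1) unfolding monomial_order_def by blast
    moreover have "mle (v + u') (v' + u')" using order that(2) unfolding monomial_order_def by blast
    ultimately show ?thesis by (metis add.commute order.trans)
  qed
  have add_strict: "u = ?s \<and> v = ?t" if uv: "mle u ?s" "mle v ?t" "u + v = ?s + ?t" for u v
  proof -
    have "mle (v + ?s) (?t + ?s)" using order uv(2) unfolding monomial_order_def by blast
    then have "mle (?s + v) (u + v)" unfolding uv(3) by (simp add: add.commute)
    then have "u = ?s"
      using monomial_order_add_strict[OF order uv(1), of v] monomial_order_antisym[OF order] by metis
    then show ?thesis using uv(3) by simp
  qed
  have f': "u \<in> Poly_Mapping.keys f \<and> u \<noteq> ?s" if "u \<in> Poly_Mapping.keys ?f'" for u
    using that by (auto simp: in_keys_iff lookup_minus lookup_single when_def split: if_splits)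
  have g': "v \<in> Poly_Mapping.keys g \<and> v \<noteq> ?t" if "v \<in> Poly_Mapping.keys ?g'" for v
    using that by (auto simp: in_keys_iff lookup_minus lookup_single when_def split: if_splits)
  have product_keys: "\<exists>u\<in>Poly_Mapping.keys p. \<exists>v\<in>Poly_Mapping.keys q. w = u + v"
    if "w \<in> Poly_Mapping.keys (p * q)" for w and p q :: "('x, 'k) mpol"
    using that Poly_Mapping.keys_mult[of p q] by blast
  have "?s + ?t \<notin> Poly_Mapping.keys (Poly_Mapping.single ?s ?a * ?g')"
  proof
    assume "?s + ?t \<in> Poly_Mapping.keys (Poly_Mapping.single ?s ?a * ?g')"
    then obtain v where "v \<in> Poly_Mapping.keys ?g'" "?s + ?t = ?s + v"
      using product_keys by (fastforce split: if_splits)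
    then show False using g'[of v] by simp
  qed
  moreover have "?s + ?t \<notin> Poly_Mapping.keys (?f' * g)"
  proof
    assume "?s + ?t \<in> Poly_Mapping.keys (?f' * g)"
    then obtain u v where "u \<in> Poly_Mapping.keys ?f'" "v \<in> Poly_Mapping.keys g" "?s + ?t = u + v"
      using product_keys by blast
    then show False using f'[of u] add_strict[of u v] f(2) g(2) by simp
  qed
  moreover have "f * g = Poly_Mapping.single (?s + ?t) (?a * ?b) + Poly_Mapping.single ?s ?a * ?g' + ?f' * g"
    by (simp add: algebra_simps flip: mult_single)
  ultimately have "Poly_Mapping.lookup (f * g) (?s + ?t) = ?a * ?b"
    by (simp add: lookup_add in_keys_iff)
  then have key: "?s + ?t \<in> Poly_Mapping.keys (f * g)"
    using f(1) g(1) by (simp add: in_keys_iff)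
  then show "f * g \<noteq> 0" by auto
  show "initial_mon mle (f * g) = ?s + ?t"
    using order key
  proof (rule initial_monI)
    fix w assume "w \<in> Poly_Mapping.keys (f * g)"
    then show "mle w (?s + ?t)" using product_keys[of w f g] add_mono f(2) g(2) by blast
  qed
qed

section \<open>Generators of an equigenerated ideal and of its square\<close>

locale equigenerated_ideal =
  fixes mle :: "('x::finite) mon \<Rightarrow> 'x mon \<Rightarrow> bool"
    and I :: "('x, 'k::field) mpol set" and d :: nat and B :: "('x, 'k) mpol set"
  assumes order: "monomial_order mle" and graded: "graded_ideal I"
    and homogeneous_generators: "\<And>f. f \<in> B \<Longrightarrow> homogeneous d f"
    and generated: "I = rmod.span B" and nonzero: "I \<noteq> {0}"
begin

definition initial_mons :: "'x mon set"
  where "initial_mons = {initial_mon mle f | f. f \<in> I \<and> f \<noteq> 0 \<and> homogeneous d f}"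

definition pivot :: "'x mon \<Rightarrow> ('x, 'k) mpol"
  where "pivot s = (SOME f. f \<in> I \<and> f \<noteq> 0 \<and> homogeneous d f \<and> initial_mon mle f = s)"

lemma pivot:
  assumes "s \<in> initial_mons"
  shows "pivot s \<in> I" "pivot s \<noteq> 0" "homogeneous d (pivot s)" "initial_mon mle (pivot s) = s"
proof -
  have "\<exists>f. f \<in> I \<and> f \<noteq> 0 \<and> homogeneous d f \<and> initial_mon mle f = s"
    using assms unfolding initial_mons_def by blast
  from someI_ex[OF this]
  show "pivot s \<in> I" "pivot s \<noteq> 0" "homogeneous d (pivot s)" "initial_mon mle (pivot s) = s"
    unfolding pivot_def by blast+
qed

lemma subspace_I: "rmod.subspace I"
  by (simp add: generated)

lemma initial_mons_degree: "initial_mons \<subseteq> {s. mon_deg s = d}"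
  using initial_mon_max(1)[OF order] by (auto simp: initial_mons_def homogeneous_def)

lemma finite_initial_mons: "finite initial_mons"
  by (rule finite_subset[OF initial_mons_degree finite_mon_deg])

lemma min_degree_I: "f \<in> I \<Longrightarrow> Poly_Mapping.keys f \<subseteq> {s. d \<le> mon_deg s}"
proof -
  have "rmod.span B \<subseteq> {f. Poly_Mapping.keys f \<subseteq> {s. d \<le> mon_deg s}}"
    using homogeneous_generators
    by (intro rmod.span_minimal subspace_min_degree) (auto simp: homogeneous_def)
  then show "f \<in> I \<Longrightarrow> Poly_Mapping.keys f \<subseteq> {s. d \<le> mon_deg s}"
    unfolding generated by blast
qed

text \<open>
  Gaussian elimination: subtract the multiple of a pivot that cancels the initial monomial, and
  continue with a smaller initial monomial.
\<close>

lemma homogeneous_in_span_pivots: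
  assumes "f \<in> I" "homogeneous d f"
  shows "f \<in> rmod.span (pivot ` initial_mons)"
proof (cases "f = 0")
  case False
  have "\<forall>f. f \<in> I \<longrightarrow> f \<noteq> 0 \<longrightarrow> homogeneous d f \<longrightarrow> initial_mon mle f = s \<longrightarrow>
      f \<in> rmod.span (pivot ` initial_mons)" if "s \<in> initial_mons" for s
    using order finite_initial_mons _ that
  proof (rule monomial_order_finite_induct, intro allI impI)
    fix s f
    assume s: "s \<in> initial_mons"
      and IH: "\<And>t. t \<in> initial_mons \<Longrightarrow> mle t s \<Longrightarrow> t \<noteq> s \<Longrightarrow>
        \<forall>f. f \<in> I \<longrightarrow> f \<noteq> 0 \<longrightarrow> homogeneous d f \<longrightarrow> initial_mon mle f = t \<longrightarrow>
          f \<in> rmod.span (pivot ` initial_mons)"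
      and f: "f \<in> I" "f \<noteq> 0" "homogeneous d f" "initial_mon mle f = s"
    define c where "c = Poly_Mapping.lookup f s / Poly_Mapping.lookup (pivot s) s"
    define r where "r = f - Poly_Mapping.single 0 c * pivot s"
    note p = pivot[OF s]
    have "Poly_Mapping.lookup (pivot s) s \<noteq> 0"
      using initial_mon_max(1)[OF order p(2)] p(4) by (simp add: in_keys_iff)
    then have s_cancelled: "Poly_Mapping.lookup r s = 0"
      by (simp add: r_def c_def lookup_minus lookup_const_mult)
    have r_keys: "Poly_Mapping.keys r \<subseteq> Poly_Mapping.keys f \<union> Poly_Mapping.keys (pivot s)"
      by (auto simp: r_def in_keys_iff lookup_minus lookup_const_mult)
    have r: "r \<in> I" "homogeneous d r"
      using f(1) p(1) subspace_I unfolding r_def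
      by (blast intro: rmod.subspace_diff rmod.subspace_scale) (use r_keys f(3) p(3) in \<open>auto simp: homogeneous_def r_def\<close>)
    have "r \<in> rmod.span (pivot ` initial_mons)"
    proof (cases "r = 0")
      case False
      let ?t = "initial_mon mle r"
      have t: "?t \<in> Poly_Mapping.keys r" using initial_mon_max(1)[OF order False] .
      then have "?t \<in> Poly_Mapping.keys f \<union> Poly_Mapping.keys (pivot s)" using r_keys by blast
      then have "mle ?t s"
        using initial_mon_max(2)[OF order f(2)] initial_mon_max(2)[OF order p(2)] f(4) p(4) by auto
      moreover have "?t \<noteq> s" using t s_cancelled by (auto simp: in_keys_iff)
      moreover have "?t \<in> initial_mons" using r False by (auto simp: initial_mons_def)
      ultimately show ?thesis using IH r False by blast
    qed (simp add: rmod.span_zero)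
    moreover have "Poly_Mapping.single 0 c * pivot s \<in> rmod.span (pivot ` initial_mons)"
      using s by (intro rmod.span_scale rmod.span_base imageI)
    ultimately have "r + Poly_Mapping.single 0 c * pivot s \<in> rmod.span (pivot ` initial_mons)"
      by (rule rmod.span_add)
    then show "f \<in> rmod.span (pivot ` initial_mons)" by (simp add: r_def)
  qed
  moreover have "initial_mon mle f \<in> initial_mons" using assms False by (auto simp: initial_mons_def)
  ultimately show ?thesis using assms False by blast
qed (simp add: rmod.span_zero)

lemma span_pivots: "I = rmod.span (pivot ` initial_mons)"
proof
  show "rmod.span (pivot ` initial_mons) \<subseteq> I"
    using pivot(1) by (intro rmod.span_minimal subspace_I) blast
  have "B \<subseteq> rmod.span (pivot ` initial_mons)"
    using homogeneous_in_span_pivots homogeneous_generators rmod.span_base[of _ B] generated by blast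
  then have "rmod.span B \<subseteq> rmod.span (pivot ` initial_mons)" by (intro rmod.span_minimal) auto
  then show "I \<subseteq> rmod.span (pivot ` initial_mons)" by (simp flip: generated)
qed

lemma num_gens_le: "num_gens I \<le> card initial_mons"
proof -
  have "num_gens I \<le> card (pivot ` initial_mons)"
    unfolding num_gens_def
    by (rule Least_le) (use finite_initial_mons span_pivots genideal_eq_span in blast)
  also have "\<dots> \<le> card initial_mons" by (rule card_image_le[OF finite_initial_mons])
  finally show ?thesis .
qed

lemma square_eq: "ideal_power I 2 = rmod.span {f * g | f g. f \<in> pivot ` initial_mons \<and> g \<in> pivot ` initial_mons}"
proof -
  have "ideal_power I 1 = I"
  proof -
    have "f \<in> rmod.span {1}" for f :: "('x, 'k) mpol"
      using rmod.span_scale[OF rmod.span_base[of 1 "{1}"], of f] by simp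
    then have "ideal_power I 0 = rmod.span {1}" by (auto simp: ideal_power_0)
    then have "ideal_power I (Suc 0) = rmod.span {b * c |b c. b \<in> {1} \<and> c \<in> B}"
      unfolding ideal_power_Suc generated by (simp only: ideal_prod_span)
    then show ?thesis by (simp add: generated)
  qed
  then have "ideal_power I 2 = I \<cdot>\<^bsub>polyring\<^esub> I"
    using ideal_power_Suc[of I 1] by (simp add: numeral_2_eq_2)
  then show ?thesis by (subst (asm) (1 2) span_pivots) (simp only: ideal_prod_span)
qed

lemma min_degree_square: "f \<in> ideal_power I 2 \<Longrightarrow> Poly_Mapping.keys f \<subseteq> {s. 2 * d \<le> mon_deg s}"
proof -
  have "homogeneous (2 * d) (pivot s * pivot t)" if "s \<in> initial_mons" "t \<in> initial_mons" for s t
    using homogeneous_mult[OF pivot(3)[OF that(1)] pivot(3)[OF that(2)]] by (simp add: mult_2)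
  then have "ideal_power I 2 \<subseteq> {f. Poly_Mapping.keys f \<subseteq> {s. 2 * d \<le> mon_deg s}}"
    unfolding square_eq by (intro rmod.span_minimal subspace_min_degree) (auto simp: homogeneous_def)
  then show "f \<in> ideal_power I 2 \<Longrightarrow> Poly_Mapping.keys f \<subseteq> {s. 2 * d \<le> mon_deg s}" by blast
qed

text \<open>
  The products of pivots have as initial monomials all sums of two initial monomials, so the
  component of \<open>I\<^sup>2\<close> in degree \<open>2d\<close> has at least that dimension. The same component is spanned over the
  field by the components in degree \<open>2d\<close> of any generators of \<open>I\<^sup>2\<close>, since \<open>I\<^sup>2\<close> starts in this degree.
\<close>

lemma card_sumset_le_num_gens_square: "card (initial_mons + initial_mons) \<le> num_gens (ideal_power I 2)"
proof -
  let ?SS = "{f * g | f g. f \<in> pivot ` initial_mons \<and> g \<in> pivot ` initial_mons}"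
  have "?SS = (\<lambda>(s, t). pivot s * pivot t) ` (initial_mons \<times> initial_mons)" by force
  then have "finite ?SS" using finite_initial_mons by simp
  \<comment> \<open>A finite generating set has to be exhibited for \<^const>\<open>num_gens\<close> to be the size of one.\<close>
  then have "\<exists>c C. finite C \<and> card C = c \<and> ideal_power I 2 = Idl\<^bsub>polyring\<^esub> C"
    using square_eq genideal_eq_span by blast
  from LeastI_ex[OF this] obtain C where C: "finite C" "card C = num_gens (ideal_power I 2)"
    "ideal_power I 2 = rmod.span C"
    unfolding num_gens_def genideal_eq_span by blast
  have "\<exists>f. f \<in> ideal_power I 2 \<and> homogeneous (2 * d) f \<and> f \<noteq> 0 \<and> initial_mon mle f = w"
    if w: "w \<in> initial_mons + initial_mons" for w
  proof -
    obtain s t where st: "w = s + t" "s \<in> initial_mons" "t \<in> initial_mons"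
      using w by (auto elim: set_plus_elim)
    have "pivot s * pivot t \<in> ideal_power I 2"
      unfolding square_eq using st by (intro rmod.span_base) blast
    moreover have "homogeneous (2 * d) (pivot s * pivot t)"
      using homogeneous_mult[OF pivot(3)[OF st(2)] pivot(3)[OF st(3)]] by (simp add: mult_2)
    ultimately show ?thesis
      using initial_mon_mult[OF order pivot(2)[OF st(2)] pivot(2)[OF st(3)]]
        pivot(4)[OF st(2)] pivot(4)[OF st(3)] st(1) by metis
  qed
  then obtain y where y: "\<And>w. w \<in> initial_mons + initial_mons \<Longrightarrow> y w \<in> ideal_power I 2 \<and>
      homogeneous (2 * d) (y w) \<and> y w \<noteq> 0 \<and> initial_mon mle (y w) = w"
    by metis
  let ?hc = "hom_component (2 * d) :: ('x, 'k) mpol \<Rightarrow> _"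
  have component_in_span: "?hc f \<in> mpol_space.span (?hc ` C)" if "f \<in> rmod.span C" for f
    using that
  proof (induction rule: rmod.span_induct_alt)
    case base
    have "?hc 0 = 0" by (rule hom_component_homogeneous) (simp add: homogeneous_def)
    then show ?case by (simp add: mpol_space.span_zero)
  next
    case (step h b f)
    have "b \<in> ideal_power I 2" using step(1) C(3) by (simp add: rmod.span_base)
    then have "?hc (h * b + f) = Poly_Mapping.single 0 (Poly_Mapping.lookup h 0) * ?hc b + ?hc f"
      by (simp add: hom_component_add hom_component_mult_min_degree min_degree_square)
    moreover have "Poly_Mapping.single 0 (Poly_Mapping.lookup h 0) * ?hc b + ?hc f \<in> mpol_space.span (?hc ` C)"
      using step by (intro mpol_space.span_add mpol_space.span_scale[OF mpol_space.span_base]) auto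
    ultimately show ?case by simp
  qed
  have "card (initial_mons + initial_mons) \<le> card (?hc ` C)"
  proof (rule mpol_space.card_family_le[of _ _ y])
    show "finite (?hc ` C)" "finite (initial_mons + initial_mons)"
      using C(1) finite_initial_mons by (auto simp: finite_set_plus)
    show "y w \<in> mpol_space.span (?hc ` C)" if "w \<in> initial_mons + initial_mons" for w
      using component_in_span[of "y w"] y[OF that] C(3) hom_component_homogeneous by metis
    show "(\<Sum>w\<in>E. Poly_Mapping.single 0 (u w) * y w) \<noteq> 0"
      if E: "E \<subseteq> initial_mons + initial_mons" "E \<noteq> {}" and u: "\<And>w. w \<in> E \<Longrightarrow> u w \<noteq> 0" for E u
    proof -
      interpret linorder mle "\<lambda>s t. mle s t \<and> s \<noteq> t" using order by (rule monomial_order_linorder)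
      have finE: "finite E" using finite_subset[OF E(1)] finite_initial_mons by (simp add: finite_set_plus)
      let ?m = "Max E"
      have m: "?m \<in> E" "\<And>w. w \<in> E \<Longrightarrow> mle w ?m" using finE E(2) by simp_all
      have other: "Poly_Mapping.lookup (y w) ?m = 0" if "w \<in> E" "w \<noteq> ?m" for w
      proof (rule ccontr)
        assume "Poly_Mapping.lookup (y w) ?m \<noteq> 0"
        then have "mle ?m w"
          using initial_mon_max(2)[OF order, of "y w" ?m] y[of w] E(1) that(1) by (auto simp: in_keys_iff)
        then show False using m(2)[OF that(1)] that(2) monomial_order_antisym[OF order] by blast
      qed
      have "Poly_Mapping.lookup (\<Sum>w\<in>E. Poly_Mapping.single 0 (u w) * y w) ?m =
          (\<Sum>w\<in>E. u w * Poly_Mapping.lookup (y w) ?m)"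
        by (simp add: lookup_sum lookup_const_mult)
      also have "\<dots> = (\<Sum>w\<in>{?m}. u w * Poly_Mapping.lookup (y w) ?m)"
        using finE m(1) other by (intro sum.mono_neutral_right) auto
      also have "\<dots> \<noteq> 0"
        using u[OF m(1)] initial_mon_max(1)[OF order, of "y ?m"] y[of ?m] m(1) E(1)
        by (auto simp: in_keys_iff)
      finally show ?thesis by auto
    qed
  qed
  also have "\<dots> \<le> card C" by (rule card_image_le[OF C(1)])
  finally show ?thesis using C(2) by simp
qed

section \<open>The ideal of lowest initial monomials\<close>

lemma initial_degree_eq: "initial_degree I = d"
  unfolding initial_degree_def
proof (rule Least_equality)
  have "\<not> B \<subseteq> {0}"
  proof
    assume "B \<subseteq> {0}"
    then have "I \<subseteq> {0}" unfolding generated by (rule rmod.span_minimal) simp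
    then show False using nonzero rmod.subspace_0[OF subspace_I] by blast
  qed
  then obtain f where "f \<in> B" "f \<noteq> 0" by blast
  then show "\<exists>f\<in>I. f \<noteq> 0 \<and> homogeneous d f"
    using homogeneous_generators generated rmod.span_base by blast
  fix e assume "\<exists>f\<in>I. f \<noteq> 0 \<and> homogeneous e f"
  then obtain f where f: "f \<in> I" "f \<noteq> 0" "homogeneous e f" by blast
  then show "d \<le> e"
    using initial_mon_max(1)[OF order f(2)] min_degree_I[OF f(1)] by (auto simp: homogeneous_def)
qed

text \<open>
  A monomial of degree \<open>d\<close> in the initial ideal is a multiple of the initial monomial of some \<open>f \<in> I\<close>.
  That monomial has degree at least \<open>d\<close>, so the two are equal, and \<open>f\<close> can be replaced by its component
  of degree \<open>d\<close>.
\<close>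

lemma lowest_initial_ideal_eq: "lowest_initial_ideal mle I = Idl\<^bsub>polyring\<^esub> (mon_poly ` initial_mons)"
proof -
  let ?M = "{initial_mon mle f | f. f \<in> I \<and> f \<noteq> 0}"
  have in_I: "initial_ideal mle I = rmod.span (mon_poly ` ?M)"
    unfolding initial_ideal_def genideal_eq_span by (rule arg_cong[of _ _ rmod.span]) blast
  have "s \<in> initial_mons" if deg: "mon_deg s = d" and s: "mon_poly s \<in> initial_ideal mle I" for s
  proof -
    have "s \<in> Poly_Mapping.keys (mon_poly s :: ('x, 'k) mpol)" by (simp add: mon_poly_def)
    then obtain t u where tu: "t \<in> ?M" "s = t + u"
      by (rule keys_multiple_of_monomials[OF s[unfolded in_I]])
    then obtain f where f: "f \<in> I" "f \<noteq> 0" "t = initial_mon mle f" by blast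
    note init = initial_mon_max[OF order f(2)]
    have "d \<le> mon_deg t" using init(1) min_degree_I[OF f(1)] f(3) by auto
    then have "u = 0" using deg tu(2) by (simp add: mon_deg_add flip: mon_deg_eq_0_iff)
    then have s_eq: "s = initial_mon mle f" using tu(2) f(3) by simp
    then have key: "s \<in> Poly_Mapping.keys (hom_component d f)"
      using init(1) deg by (simp add: keys_hom_component)
    then have "initial_mon mle (hom_component d f) = s"
      by (rule initial_monI[OF order]) (use init(2) s_eq in \<open>simp add: keys_hom_component\<close>)
    moreover have "hom_component d f \<in> I" using graded f(1) by (simp add: graded_ideal_def)
    moreover have "hom_component d f \<noteq> 0" using key by auto
    ultimately show ?thesis
      unfolding initial_mons_def using homogeneous_hom_component by blast
  qed
  moreover have "mon_poly s \<in> initial_ideal mle I" if "s \<in> initial_mons" for s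
    unfolding in_I using that by (intro rmod.span_base imageI) (auto simp: initial_mons_def)
  ultimately have "{mon_poly s | s. mon_deg s = initial_degree I \<and> mon_poly s \<in> initial_ideal mle I} =
      (mon_poly ` initial_mons :: ('x, 'k) mpol set)"
    using initial_mons_degree unfolding initial_degree_eq by blast
  then show ?thesis unfolding lowest_initial_ideal_def by simp
qed

lemma monomial_ideal_eq:
  assumes "monomial_ideal I"
  shows "I = Idl\<^bsub>polyring\<^esub> (mon_poly ` initial_mons)"
proof -
  obtain M where M: "I = rmod.span (mon_poly ` M)"
    using assms unfolding monomial_ideal_def genideal_eq_span by blast
  have mon_in_I: "mon_poly s \<in> I" if f: "f \<in> I" and s: "s \<in> Poly_Mapping.keys f" for f s
  proof -
    obtain t u where tu: "t \<in> M" "s = t + u"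
      using keys_multiple_of_monomials[OF f[unfolded M] s] .
    then have "mon_poly u * mon_poly t \<in> I" unfolding M by (intro rmod.span_scale rmod.span_base imageI)
    then show ?thesis unfolding tu(2) mon_poly_add by (simp add: mult.commute)
  qed
  have "rmod.span B \<subseteq> rmod.span (mon_poly ` initial_mons)"
  proof (rule rmod.span_minimal)
    show "B \<subseteq> rmod.span (mon_poly ` initial_mons)"
    proof
      fix f assume f: "f \<in> B"
      have "Poly_Mapping.keys f \<subseteq> initial_mons"
      proof
        fix s assume s: "s \<in> Poly_Mapping.keys f"
        have "mon_poly s \<in> I" using f s generated rmod.span_base mon_in_I by blast
        moreover have "homogeneous d (mon_poly s :: ('x, 'k) mpol)"
          using homogeneous_generators[OF f] s by (simp add: homogeneous_def mon_poly_def)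
        moreover have "mon_poly s \<noteq> (0 :: ('x, 'k) mpol)"
          by (metis keys_zero empty_iff insertI1 keys_single mon_poly_def one_neq_zero)
        moreover have "initial_mon mle (mon_poly s :: ('x, 'k) mpol) = s"
          by (rule initial_monI[OF order])
            (use order in \<open>auto simp: mon_poly_def monomial_order_def class.linorder_def class.order_def class.preorder_def\<close>)
        ultimately show "s \<in> initial_mons" unfolding initial_mons_def by force
      qed
      then show "f \<in> rmod.span (mon_poly ` initial_mons)" by (rule mem_span_monomials)
    qed
  qed simp
  moreover have "rmod.span (mon_poly ` initial_mons) \<subseteq> I"
  proof (rule rmod.span_minimal[OF _ subspace_I])
    show "mon_poly ` initial_mons \<subseteq> I"
      using mon_in_I initial_mon_max(1)[OF order] by (auto simp: initial_mons_def)
  qed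
  ultimately show ?thesis unfolding genideal_eq_span generated[symmetric] by blast
qed

end

section \<open>The inequality\<close>

text \<open>
  From \<open>r\<close> to \<open>r + 1\<close> the expression \<open>r n - (r choose 2)\<close> grows by \<open>n - r\<close>.
\<close>

lemma freiman_bound_mono:
  fixes l r n :: nat
  assumes "l \<le> r" "r \<le> n"
  shows "l * n + (r choose 2) \<le> r * n + (l choose 2)"
  using assms
proof (induction r rule: dec_induct)
  case (step r)
  moreover have "(Suc r choose 2) = r + (r choose 2)" by (simp add: numeral_2_eq_2)
  ultimately show ?case by simp
qed simp

lemma num_gens_square_bound:
  fixes mle :: "('x::finite) mon \<Rightarrow> 'x mon \<Rightarrow> bool" and A :: "'x mon set"
  assumes "monomial_order mle" "finite A" "l \<le> affine_rank A" "g \<le> card A" "card (A + A) \<le> g2"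
  shows "int l * int g - int (l choose 2) \<le> int g2"
proof -
  have "l * g + (affine_rank A choose 2) \<le> l * card A + (affine_rank A choose 2)"
    using assms(4) by simp
  also have "\<dots> \<le> affine_rank A * card A + (l choose 2)"
    by (rule freiman_bound_mono[OF assms(3) affine_rank_le_card[OF assms(2)]])
  also have "\<dots> \<le> g2 + (affine_rank A choose 2) + (l choose 2)"
    using freiman_inequality[OF assms(1,2)] assms(5) by simp
  finally have "l * g \<le> g2 + (l choose 2)" by simp
  then show ?thesis by (metis of_nat_add of_nat_le_iff of_nat_mult diff_le_eq)
qed

theorem theorem1p9:
  fixes mle :: "('x::finite) mon \<Rightarrow> 'x mon \<Rightarrow> bool"
    and I :: "('x, 'k::field) mpol set"
  assumes "monomial_order mle"
    and "graded_ideal I"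
    and "equigenerated I"
    and "I \<noteq> {0}"
  shows "int (num_gens (ideal_power I 2)) \<ge>
           int (analytic_spread (lowest_initial_ideal mle I)) * int (num_gens I)
           - int (analytic_spread (lowest_initial_ideal mle I) choose 2) \<and>
         (monomial_ideal I \<longrightarrow>
           int (num_gens (ideal_power I 2)) \<ge>
             int (analytic_spread I) * int (num_gens I) - int (analytic_spread I choose 2))"
proof -
  obtain d B where B: "\<forall>f\<in>B. homogeneous d f" "I = Idl\<^bsub>polyring\<^esub> B"
    using assms(3) unfolding equigenerated_def by blast
  interpret equigenerated_ideal mle I d B
    using assms B by unfold_locales (auto simp: genideal_eq_span)
  let ?J = "Idl\<^bsub>polyring\<^esub> (mon_poly ` initial_mons) :: ('x, 'k) mpol set"
  have bound: "int (analytic_spread ?J) * int (num_gens I) - int (analytic_spread ?J choose 2)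
      \<le> int (num_gens (ideal_power I 2))"
    using assms(1) finite_initial_mons analytic_spread_le_affine_rank[OF finite_initial_mons]
      num_gens_le card_sumset_le_num_gens_square by (rule num_gens_square_bound)
  show ?thesis
  proof (intro conjI impI)
    show "int (analytic_spread (lowest_initial_ideal mle I)) * int (num_gens I)
        - int (analytic_spread (lowest_initial_ideal mle I) choose 2) \<le> int (num_gens (ideal_power I 2))"
      unfolding lowest_initial_ideal_eq by (rule bound)
    assume "monomial_ideal I"
    from monomial_ideal_eq[OF this]
    show "int (analytic_spread I) * int (num_gens I) - int (analytic_spread I choose 2)
        \<le> int (num_gens (ideal_power I 2))"
      using bound by simp
  qed
qed

end
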